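(* Consider the repeated two-player zero-sum Bayesian game with a rate-limited helper described in the context, with finite state set $\mathcal{S}$, finite action sets $\mathcal{A}$ (Player A) and $\mathcal{B}$ (Player B), state distribution $p_S$ and finite real payoff function $\Pi(a,b,s)$ to Player A. (i) Suppose Player B does not know the state sequence. Then an average payoff $P$ for Player A is achievable with a state-information description rate $R$ if there exist a finite-valued auxiliary random variable $U$ and an action $A$ with joint distribution $p_S(s)\,p_{U|S}(u|s)\,p_{A|U}(a|u)$ (so that $S - U - A$ is a Markov chain) such that \[ \underline{\Pi}_{p_{A|S}} > P,\qquad R > I(U;S),\qquad R > I(U;S,A)\,\frac{P - \underline{\Pi}_{p_{A|U}}^{(U)}}{\underline{\Pi}_{p_{A|S}} - \underline{\Pi}_{p_{A|U}}^{(U)}}. \] (ii) Suppose Player B knows the state sequence. Then an average payoff $P$ for Player A is achievable with a state-information description rate $R$ if there exist a finite-valued auxiliary random variable $U$ and an action $A$ with joint distribution $p_S(s)\,p_{U|S}(u|s)\,p_{A|U}(a|u)$ such that \[ \underline{\Pi}_{p_{A|S}}^{(S)} > P,\qquad R > I(U;S) + I(U;A|S)\left(\frac{P - \underline{\Pi}_{p_{A|U}}^{(S,U)}}{\underline{\Pi}_{p_{A|S}}^{(S)} - \underline{\Pi}_{p_{A|U}}^{(S,U)}}\right)^{+}. \]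
   Context: Setting. A two-player zero-sum game has a random state $S$ taking values in a finite set $\mathcal{S}$ with distribution $p_S$; Player A chooses a pure strategy $a\in\mathcal{A}$, Player B chooses $b\in\mathcal{B}$ (finite sets), and Player A receives the finite payoff $\Pi(a,b,s)$ while Player B receives $-\Pi(a,b,s)$. The game is repeated: a block of $n$ iterations is played with states $S_1,\dots,S_n$ i.i.d. according to $p_S$. A helper observes the whole state sequence $S^n=(S_1,\dots,S_n)$ non-causally and sends Player A a message of $nR$ bits (rate $R$ bits per iteration) before play; the helper's encoding and Player A's use of the message may be randomized. At each iteration both players know all past actions and past states. Player B knows the communication protocol (encoder and Player A's strategy) but does not see the message; in case (i) Player B has no further information about the states, while in case (ii) Player B additionally observes the entire state sequence $S^n$. An average payoff $P$ is achievable at rate $R$ if for large enough block length $n$ there is such a rate-$R$ protocol for the helper and Player A guaranteeing Player A an expected per-iteration average payoff of (arbitrarily close to) at least $P$ against every strategy of Player B. Notation. For a conditional distribution $p_{A|S}$, and for $p_{U|S},p_{A|U}$ with joint distribution $p_S p_{U|S} p_{A|U}$ (with induced $p_U$, $p_{S|U}$, and $p_{A|S}(a|s)=\sum_u p_{U|S}(u|s)p_{A|U}(a|u)$), define \[\underline{\Pi}_{p_{A|S}} = \min_{p_B}\sum_{a,b,s} p_S(s)p_{A|S}(a|s)p_B(b)\Pi(a,b,s),\] \[\underline{\Pi}_{p_{A|S}}^{(S)} = \min_{p_{B|S}}\sum_{a,b,s} p_S(s)p_{A|S}(a|s)p_{B|S}(b|s)\Pi(a,b,s),\] \[\underline{\Pi}_{p_{A|U}}^{(U)}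 = \min_{p_{B|U}}\sum_{a,b,s,u} p_U(u)p_{S|U}(s|u)p_{A|U}(a|u)p_{B|U}(b|u)\Pi(a,b,s),\] \[\underline{\Pi}_{p_{A|U}}^{(S,U)} = \min_{p_{B|S,U}}\sum_{a,b,s,u} p_U(u)p_{S|U}(s|u)p_{A|U}(a|u)p_{B|S,U}(b|s,u)\Pi(a,b,s),\] i.e. the minimum expected payoff to Player A when Player B knows nothing, knows $S$, knows $U$, or knows $(S,U)$ respectively. $I(\cdot;\cdot)$ denotes mutual information (in bits) and $I(\cdot;\cdot|\cdot)$ conditional mutual information under this joint distribution; $(x)^+=\max(x,0)$. *)

theory Defs
  imports "HOL-Probability.Probability"
begin

definition induced_AS :: "('s \<Rightarrow> 'u pmf) \<Rightarrow> ('u \<Rightarrow> 'a pmf) \<Rightarrow> 's \<Rightarrow> 'a pmf" where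
  "induced_AS pUS pAU = (\<lambda>s. bind_pmf (pUS s) pAU)"

definition lowPi :: "'s pmf \<Rightarrow> ('a \<Rightarrow> 'b \<Rightarrow> 's \<Rightarrow> real) \<Rightarrow> ('s \<Rightarrow> 'a pmf) \<Rightarrow> real" where
  "lowPi pS Pay pAS = (INF pB :: 'b pmf.
     (\<Sum>a\<in>UNIV. \<Sum>b\<in>UNIV. \<Sum>s\<in>UNIV. pmf pS s * pmf (pAS s) a * pmf pB b * Pay a b s))"

definition lowPi_S :: "'s pmf \<Rightarrow> ('a \<Rightarrow> 'b \<Rightarrow> 's \<Rightarrow> real) \<Rightarrow> ('s \<Rightarrow> 'a pmf) \<Rightarrow> real" where
  "lowPi_S pS Pay pAS = (INF pBS :: 's \<Rightarrow> 'b pmf.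
     (\<Sum>a\<in>UNIV. \<Sum>b\<in>UNIV. \<Sum>s\<in>UNIV. pmf pS s * pmf (pAS s) a * pmf (pBS s) b * Pay a b s))"

text \<open>Player B knows U.  The joint p_U(u) p_{S|U}(s|u) is written as p_S(s) p_{U|S}(u|s).\<close>
definition lowPi_U :: "'s pmf \<Rightarrow> ('a \<Rightarrow> 'b \<Rightarrow> 's \<Rightarrow> real) \<Rightarrow> ('s \<Rightarrow> 'u pmf) \<Rightarrow> ('u \<Rightarrow> 'a pmf) \<Rightarrow> real" where
  "lowPi_U pS Pay pUS pAU = (INF pBU :: 'u \<Rightarrow> 'b pmf.
     (\<Sum>a\<in>UNIV. \<Sum>b\<in>UNIV. \<Sum>s\<in>UNIV. \<Sum>u\<in>UNIV.
        pmf pS s * pmf (pUS s) u * pmf (pAU u) a * pmf (pBU u) b * Pay a b s))"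

definition lowPi_SU :: "'s pmf \<Rightarrow> ('a \<Rightarrow> 'b \<Rightarrow> 's \<Rightarrow> real) \<Rightarrow> ('s \<Rightarrow> 'u pmf) \<Rightarrow> ('u \<Rightarrow> 'a pmf) \<Rightarrow> real" where
  "lowPi_SU pS Pay pUS pAU = (INF pBSU :: 's \<Rightarrow> 'u \<Rightarrow> 'b pmf.
     (\<Sum>a\<in>UNIV. \<Sum>b\<in>UNIV. \<Sum>s\<in>UNIV. \<Sum>u\<in>UNIV.
        pmf pS s * pmf (pUS s) u * pmf (pAU u) a * pmf (pBSU s u) b * Pay a b s))"

definition mutual_info :: "('x \<times> 'y \<Rightarrow> real) \<Rightarrow> real" where
  "mutual_info J = (\<Sum>(x,y)\<in>UNIV. if J (x,y) = 0 then 0 else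
      J (x,y) * log 2 (J (x,y) / ((\<Sum>y'\<in>UNIV. J (x,y')) * (\<Sum>x'\<in>UNIV. J (x',y)))))"

definition cond_mutual_info :: "('x \<times> 'y \<times> 'z \<Rightarrow> real) \<Rightarrow> real" where
  "cond_mutual_info J = (\<Sum>(x,y,z)\<in>UNIV. if J (x,y,z) = 0 then 0 else
      J (x,y,z) * log 2 (J (x,y,z) * (\<Sum>x'\<in>UNIV. \<Sum>y'\<in>UNIV. J (x',y',z)) /
        ((\<Sum>y'\<in>UNIV. J (x,y',z)) * (\<Sum>x'\<in>UNIV. J (x',y,z)))))"

definition joint_SUA :: "'s pmf \<Rightarrow> ('s \<Rightarrow> 'u pmf) \<Rightarrow> ('u \<Rightarrow> 'a pmf) \<Rightarrow> 's \<Rightarrow> 'u \<Rightarrow> 'a \<Rightarrow> real" where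
  "joint_SUA pS pUS pAU s u a = pmf pS s * pmf (pUS s) u * pmf (pAU u) a"

fun iid_list :: "'s pmf \<Rightarrow> nat \<Rightarrow> 's list pmf" where
  "iid_list p 0 = return_pmf []"
| "iid_list p (Suc n) = bind_pmf p (\<lambda>x. bind_pmf (iid_list p n) (\<lambda>xs. return_pmf (x # xs)))"

text \<open>Play of the first i iterations given the full state sequence ss and message m.
  Player A's (behavioural) strategy fa sees the message, the past states and the
  past action pairs; Player B's strategy gb sees bview i ss (its state information
  at iteration i) and the past action pairs.  Both choose simultaneously and
  independently given the history.\<close>
fun play :: "(nat \<Rightarrow> 's list \<Rightarrow> ('a \<times> 'b) list \<Rightarrow> 'a pmf) \<Rightarrow>
             ('s list \<Rightarrow> ('a \<times> 'b) list \<Rightarrow> 'b pmf) \<Rightarrow>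
             (nat \<Rightarrow> 's list \<Rightarrow> 's list) \<Rightarrow> nat \<Rightarrow> 's list \<Rightarrow> nat \<Rightarrow> ('a \<times> 'b) list pmf" where
  "play fa gb bview m ss 0 = return_pmf []"
| "play fa gb bview m ss (Suc i) =
     bind_pmf (play fa gb bview m ss i) (\<lambda>h.
       bind_pmf (fa m (take i ss) h) (\<lambda>a.
         bind_pmf (gb (bview i ss) h) (\<lambda>b. return_pmf (h @ [(a, b)]))))"

definition num_msgs :: "nat \<Rightarrow> real \<Rightarrow> nat" where
  "num_msgs n R = nat \<lfloor>2 powr (real n * R)\<rfloor>"

definition avg_payoff ::
  "'s pmf \<Rightarrow> ('a \<Rightarrow> 'b \<Rightarrow> 's \<Rightarrow> real) \<Rightarrow> (nat \<Rightarrow> 's list \<Rightarrow> 's list) \<Rightarrow> nat \<Rightarrow>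
   ('s list \<Rightarrow> nat pmf) \<Rightarrow> (nat \<Rightarrow> 's list \<Rightarrow> ('a \<times> 'b) list \<Rightarrow> 'a pmf) \<Rightarrow>
   ('s list \<Rightarrow> ('a \<times> 'b) list \<Rightarrow> 'b pmf) \<Rightarrow> real" where
  "avg_payoff pS Pay bview n enc fa gb =
     measure_pmf.expectation
       (bind_pmf (iid_list pS n) (\<lambda>ss. bind_pmf (enc ss) (\<lambda>m.
          bind_pmf (play fa gb bview m ss n) (\<lambda>h. return_pmf (ss, h)))))
       (\<lambda>(ss, h). (\<Sum>i<n. Pay (fst (h ! i)) (snd (h ! i)) (ss ! i)) / real n)"

text \<open>Achievability of average payoff P at rate R, where bview describes Player B's
  state information: (\<lambda>i ss. take i ss) = only past states (case i),
  (\<lambda>i ss. ss) = the whole state sequence (case ii).\<close>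
definition achievable ::
  "'s pmf \<Rightarrow> ('a \<Rightarrow> 'b \<Rightarrow> 's \<Rightarrow> real) \<Rightarrow> (nat \<Rightarrow> 's list \<Rightarrow> 's list) \<Rightarrow> real \<Rightarrow> real \<Rightarrow> bool" where
  "achievable pS Pay bview R P \<longleftrightarrow>
     (\<forall>\<epsilon>>0. \<exists>N. \<forall>n\<ge>N. \<exists>(enc :: 's list \<Rightarrow> nat pmf) (fa :: nat \<Rightarrow> 's list \<Rightarrow> ('a \<times> 'b) list \<Rightarrow> 'a pmf).
        (\<forall>ss. set_pmf (enc ss) \<subseteq> {..<num_msgs n R}) \<and>
        (\<forall>gb :: 's list \<Rightarrow> ('a \<times> 'b) list \<Rightarrow> 'b pmf.
           avg_payoff pS Pay bview n enc fa gb \<ge> P - \<epsilon>))"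

end

theory Submission
  imports Defs "HOL-Real_Asymp.Real_Asymp"
begin

text \<open>
  Player A ignores the play and uses \<open>p\<^bsub>A|U\<^esub>\<close> along the codeword of a random i.i.d. codebook that
  the message selects; the helper draws the message with probability proportional to the likelihood
  of the state sequence under the codeword. By the soft covering lemma, \<open>R > I(U;S)\<close> makes the joint
  law of message and states close in total variation to the ideal one, in which the message is
  uniform and the states are the output of the reversed channel \<open>p\<^bsub>S|U\<^esub>\<close>. Under the ideal law, soft
  covering with output \<open>(S, A)\<close> over the first \<open>k = \<lfloor>\<tau> n\<rfloor>\<close> iterations, where \<open>\<tau>\<close> is the fraction in the
  statement, shows that whatever Player B observes in that period looks i.i.d., hence reveals nothing
  about the current action. Afterwards Player B may be assumed to know the codeword; averaged over
  codebooks, the payoff is then still the single-letter one for known \<open>U\<close>. All these bounds hold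
  uniformly in Player B's strategy, so some codebook attains their average.
\<close>

section \<open>Product distributions on lists\<close>

text \<open>The two rate formulas differ because Player B observes different things. Uninformed,
  Player B has seen during the first \<open>k\<close> iterations only pairs (s, a) from that period,
  so the covered output may be blanked after \<open>k\<close>: cost \<tau> I(U;S,A), beside the cost
  I(U;S) of simulating the states. Informed, Player B sees all \<open>n\<close> states at once, so
  the states stay in the output throughout and only actions are blanked: cost \<tau> I(U;S,A) + (1 -
  \<tau>) I(U;S), which the chain rule turns into I(U;S) + \<tau> I(U;A|S). The obstacle is that
  Player B adapts to past play. Since Player A plays open loop, Player B's randomness can be
  integrated out; each strategy then becomes a bounded function of the state and action sequences,
  and an L1 bound between laws of these sequences controls all such functions at once. Only
  convergence to 0 is wanted, so Chebyshev's inequality takes the place of exponential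
  bounds.\<close>

abbreviation E :: "'x pmf \<Rightarrow> ('x \<Rightarrow> real) \<Rightarrow> real" where
  "E p f \<equiv> measure_pmf.expectation p f"

fun iprod :: "(nat \<Rightarrow> 'x pmf) \<Rightarrow> nat \<Rightarrow> 'x list pmf" where
  "iprod q 0 = return_pmf []"
| "iprod q (Suc n) = bind_pmf (q 0) (\<lambda>x. map_pmf ((#) x) (iprod (\<lambda>i. q (Suc i)) n))"

section \<open>Expectations over finitely supported laws\<close>

lemma expectation_bind_finite:
  assumes "finite (set_pmf p)" "\<And>x. x \<in> set_pmf p \<Longrightarrow> finite (set_pmf (f x))"
  shows "E (bind_pmf p f) g = E p (\<lambda>x. E (f x) g)"
proof -
  have "E (bind_pmf p f) g = (\<Sum>x\<in>set_pmf p. pmf p x *\<^sub>R E (f x) g)"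
    by (rule pmf_expectation_bind) (use assms in auto)
  also have "\<dots> = E p (\<lambda>x. E (f x) g)"
    by (subst integral_measure_pmf[of "set_pmf p"]) (use assms in auto)
  finally show ?thesis .
qed

lemma expectation_sum_UNIV:
  fixes p :: "'x::finite pmf"
  shows "E p f = (\<Sum>x\<in>UNIV. pmf p x * f x)"
  by (subst integral_measure_pmf[of UNIV]) auto

lemma expectation_sum_superset:
  assumes "finite A" "set_pmf p \<subseteq> A"
  shows "E p f = (\<Sum>x\<in>A. pmf p x * f x)"
  by (subst integral_measure_pmf[of A]) (use assms in auto)

lemma expectation_mono_finite:
  assumes "finite (set_pmf p)" "\<And>x. x \<in> set_pmf p \<Longrightarrow> f x \<le> g x"
  shows "E p f \<le> E p g"
  by (rule integral_mono_AE)
     (use assms in \<open>auto intro: integrable_measure_pmf_finite simp: AE_measure_pmf_iff\<close>)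

lemma expectation_cong_pmf:
  assumes "\<And>x. x \<in> set_pmf p \<Longrightarrow> f x = g x"
  shows "E p f = E p g"
  by (rule integral_cong_AE) (use assms in \<open>auto simp: AE_measure_pmf_iff\<close>)

lemma expectation_add_finite:
  "finite (set_pmf p) \<Longrightarrow> E p (\<lambda>x. f x + g x) = E p f + E p g"
  by (rule Bochner_Integration.integral_add) (auto intro: integrable_measure_pmf_finite)

lemma expectation_diff_finite:
  "finite (set_pmf p) \<Longrightarrow> E p (\<lambda>x. f x - g x) = E p f - E p g"
  by (rule Bochner_Integration.integral_diff) (auto intro: integrable_measure_pmf_finite)

lemma expectation_sum_finite:
  "finite (set_pmf p) \<Longrightarrow> E p (\<lambda>x. \<Sum>i\<in>I. f i x) = (\<Sum>i\<in>I. E p (f i))"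
  by (rule Bochner_Integration.integral_sum) (auto intro: integrable_measure_pmf_finite)

lemma expectation_const [simp]: "E p (\<lambda>_. c) = c"
  by simp

lemma abs_expectation_le:
  assumes "finite (set_pmf p)" "\<And>x. x \<in> set_pmf p \<Longrightarrow> \<bar>f x\<bar> \<le> K"
  shows "\<bar>E p f\<bar> \<le> K"
proof -
  have "E p f \<le> E p (\<lambda>_. K)" "E p (\<lambda>_. - K) \<le> E p f"
    by (rule expectation_mono_finite; use assms in \<open>auto simp: abs_le_iff minus_le_iff\<close>)+
  then show ?thesis by simp
qed

section \<open>Independent, not necessarily identically distributed sequences\<close>

lemma iid_list_eq_iprod: "iid_list p n = iprod (\<lambda>_. p) n"
  by (induction n) (auto simp: map_pmf_def)

lemma length_iprod: "xs \<in> set_pmf (iprod q n) \<Longrightarrow> length xs = n"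
  by (induction n arbitrary: q xs) auto

lemma iprod_nth_in: "xs \<in> set_pmf (iprod q n) \<Longrightarrow> i < n \<Longrightarrow> xs ! i \<in> set_pmf (q i)"
proof (induction n arbitrary: q xs i)
  case (Suc n)
  then show ?case by (cases i) auto
qed simp

lemma finite_set_iprod [simp, intro]:
  "(\<And>i. i < n \<Longrightarrow> finite (set_pmf (q i))) \<Longrightarrow> finite (set_pmf (iprod q n))"
  by (induction n arbitrary: q) auto

lemma pmf_iprod:
  "pmf (iprod q n) xs = (if length xs = n then (\<Prod>i<n. pmf (q i) (xs ! i)) else 0)"
proof (induction n arbitrary: q xs)
  case (Suc n)
  show ?case
  proof (cases xs)
    case Nil
    then show ?thesis by (auto simp: pmf_eq_0_set_pmf)
  next
    case (Cons y ys)
    have "pmf (map_pmf ((#) x) (iprod (\<lambda>i. q (Suc i)) n)) xs =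
        indicator {y} x * pmf (iprod (\<lambda>i. q (Suc i)) n) ys" for x
    proof (cases "x = y")
      case True
      then show ?thesis by (simp add: Cons pmf_map_inj')
    next
      case False
      then show ?thesis by (auto simp: Cons pmf_eq_0_set_pmf)
    qed
    then have "pmf (iprod q (Suc n)) xs = pmf (q 0) y * pmf (iprod (\<lambda>i. q (Suc i)) n) ys"
      by (simp add: pmf_bind measure_pmf_single)
    also have "\<dots> = (if length xs = Suc n then (\<Prod>i<Suc n. pmf (q i) (xs ! i)) else 0)"
      by (simp only: Suc.IH prod.lessThan_Suc_shift) (simp add: Cons)
    finally show ?thesis .
  qed
qed (auto simp: pmf_return)

text \<open>Input and memoryless channel output, zipped together, again form a product law, so
  quantities of a block pair become sums over independent letters.\<close>

lemma iprod_zip: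
  "bind_pmf (iprod p n) (\<lambda>us. map_pmf (zip us) (iprod (\<lambda>i. W i (us ! i)) n)) =
   iprod (\<lambda>i. bind_pmf (p i) (\<lambda>u. map_pmf (Pair u) (W i u))) n"
proof (induction n arbitrary: p W)
  case (Suc n)
  have "bind_pmf (iprod p (Suc n)) (\<lambda>us. map_pmf (zip us) (iprod (\<lambda>i. W i (us ! i)) (Suc n))) =
      bind_pmf (p 0) (\<lambda>u. bind_pmf (W 0 u) (\<lambda>y. map_pmf ((#) (u, y))
        (bind_pmf (iprod (\<lambda>i. p (Suc i)) n)
          (\<lambda>us. map_pmf (zip us) (iprod (\<lambda>i. W (Suc i) (us ! i)) n)))))"
    apply (simp add: map_pmf_def bind_assoc_pmf bind_return_pmf)
    apply (subst (2) bind_commute_pmf)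
    apply (rule refl)
    done
  also have "\<dots> = iprod (\<lambda>i. bind_pmf (p i) (\<lambda>u. map_pmf (Pair u) (W i u))) (Suc n)"
    by (simp only: Suc.IH[of "\<lambda>i. p (Suc i)" "\<lambda>i. W (Suc i)"] iprod.simps bind_assoc_pmf bind_map_pmf)
  finally show ?case .
qed (simp add: bind_return_pmf)

lemma iprod_map_nth:
  "map_pmf (\<lambda>xs. map (\<lambda>i. t i (xs ! i)) [0..<n]) (iprod q n) = iprod (\<lambda>i. map_pmf (t i) (q i)) n"
proof (induction n arbitrary: q t)
  case (Suc n)
  have *: "map (\<lambda>i. t i ((x # xs) ! i)) [0..<Suc n] = t 0 x # map (\<lambda>i. t (Suc i) (xs ! i)) [0..<n]" for x xs
    by (simp del: upt_Suc add: upt_conv_Cons map_Suc_upt[symmetric] o_def)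
  show ?case
    by (simp del: upt_Suc add: Suc.IH[symmetric] map_bind_pmf bind_map_pmf map_pmf_comp *)
qed simp

lemma iprod_bind:
  "bind_pmf (iprod p n) (\<lambda>us. iprod (\<lambda>i. W i (us ! i)) n) = iprod (\<lambda>i. bind_pmf (p i) (W i)) n"
proof (induction n arbitrary: p W)
  case (Suc n)
  show ?case
    apply (simp add: Suc.IH[symmetric] map_pmf_def bind_assoc_pmf bind_return_pmf)
    apply (subst (2) bind_commute_pmf)
    apply (rule refl)
    done
qed (simp add: bind_return_pmf)

text \<open>Redrawing one coordinate is how independence is used below: whatever ignores entry
  \<open>i\<close> can be held fixed while that entry is averaged.\<close>

lemma iprod_resample:
  "i < n \<Longrightarrow> bind_pmf (iprod q n) (\<lambda>xs. map_pmf (\<lambda>x. xs[i := x]) (q i)) = iprod q n"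
proof (induction n arbitrary: q i)
  case (Suc n)
  show ?case
  proof (cases i)
    case 0
    show ?thesis
      apply (simp add: 0 map_pmf_def bind_assoc_pmf bind_return_pmf)
      apply (subst bind_commute_pmf)
      apply simp
      done
  next
    case (Suc j)
    with Suc.prems have "j < n" by simp
    have "bind_pmf (iprod q (Suc n)) (\<lambda>xs. map_pmf (\<lambda>x. xs[i := x]) (q i)) =
        bind_pmf (q 0) (\<lambda>y. map_pmf ((#) y) (bind_pmf (iprod (\<lambda>i. q (Suc i)) n)
          (\<lambda>xs. map_pmf (\<lambda>x. xs[j := x]) (q (Suc j)))))"
      by (simp add: Suc map_pmf_def bind_assoc_pmf bind_return_pmf)
    also have "\<dots> = iprod q (Suc n)"
      by (simp only: Suc.IH[OF \<open>j < n\<close>, of "\<lambda>i. q (Suc i)"] iprod.simps)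
    finally show ?thesis .
  qed
qed simp

lemma iprod_nth_marginal: "i < n \<Longrightarrow> map_pmf (\<lambda>xs. xs ! i) (iprod q n) = q i"
proof (induction n arbitrary: q i)
  case (Suc n)
  then show ?case
    by (cases i) (simp_all add: map_bind_pmf map_pmf_comp bind_return_pmf' o_def)
qed simp

lemma expectation_iprod_nth:
  "i < n \<Longrightarrow> E (iprod q n) (\<lambda>xs. f (xs ! i)) = E (q i) f"
  by (metis (no_types) integral_map_pmf iprod_nth_marginal)

text \<open>The first coordinate is peeled off; the cross term vanishes because the remaining sum
  has mean 0.\<close>

lemma iprod_second_moment:
  assumes "\<And>i. i < n \<Longrightarrow> finite (set_pmf (q i))" "\<And>i. i < n \<Longrightarrow> E (q i) (f i) = 0"
  shows "E (iprod q n) (\<lambda>xs. (\<Sum>i<n. f i (xs ! i))\<^sup>2) = (\<Sum>i<n. E (q i) (\<lambda>x. (f i x)\<^sup>2))"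
  using assms
proof (induction n arbitrary: q f)
  case (Suc n)
  let ?Q = "iprod (\<lambda>i. q (Suc i)) n"
  let ?T = "\<lambda>xs. \<Sum>i<n. f (Suc i) (xs ! i)"
  have fin0: "finite (set_pmf (q 0))" and fin: "finite (set_pmf ?Q)"
    using Suc.prems(1) by auto
  have IH: "E ?Q (\<lambda>xs. (?T xs)\<^sup>2) = (\<Sum>i<n. E (q (Suc i)) (\<lambda>x. (f (Suc i) x)\<^sup>2))"
    by (rule Suc.IH) (use Suc.prems in auto)
  have mean: "E ?Q ?T = 0"
    by (simp add: expectation_sum_finite[OF fin] expectation_iprod_nth Suc.prems)
  have "E (iprod q (Suc n)) (\<lambda>xs. (\<Sum>i<Suc n. f i (xs ! i))\<^sup>2)
      = E (q 0) (\<lambda>x. E ?Q (\<lambda>xs. (f 0 x + ?T xs)\<^sup>2))"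
    using fin0 fin by (simp add: expectation_bind_finite sum.lessThan_Suc_shift del: sum.lessThan_Suc)
  also have "\<dots> = E (q 0) (\<lambda>x. (f 0 x)\<^sup>2 + E ?Q (\<lambda>xs. (?T xs)\<^sup>2))"
  proof (rule expectation_cong_pmf)
    fix x
    have "E ?Q (\<lambda>xs. (f 0 x + ?T xs)\<^sup>2) = E ?Q (\<lambda>xs. (f 0 x)\<^sup>2 + 2 * f 0 x * ?T xs + (?T xs)\<^sup>2)"
      by (simp add: power2_sum algebra_simps)
    also have "\<dots> = (f 0 x)\<^sup>2 + 2 * f 0 x * E ?Q ?T + E ?Q (\<lambda>xs. (?T xs)\<^sup>2)"
      by (simp add: expectation_add_finite[OF fin])
    finally show "E ?Q (\<lambda>xs. (f 0 x + ?T xs)\<^sup>2) = (f 0 x)\<^sup>2 + E ?Q (\<lambda>xs. (?T xs)\<^sup>2)"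
      by (simp add: mean)
  qed
  also have "\<dots> = (\<Sum>i<Suc n. E (q i) (\<lambda>x. (f i x)\<^sup>2))"
    by (simp add: expectation_add_finite[OF fin0] IH sum.lessThan_Suc_shift del: sum.lessThan_Suc)
  finally show ?case .
qed simp

section \<open>Soft covering\<close>

lemma expectation_abs_le_sqrt:
  assumes "finite (set_pmf p)"
  shows "E p (\<lambda>x. \<bar>f x\<bar>) \<le> sqrt (E p (\<lambda>x. (f x)\<^sup>2))"
proof (rule real_le_rsqrt)
  have i: "integrable (measure_pmf p) g" for g :: "_ \<Rightarrow> real"
    by (rule integrable_measure_pmf_finite[OF assms])
  show "(E p (\<lambda>x. \<bar>f x\<bar>))\<^sup>2 \<le> E p (\<lambda>x. (f x)\<^sup>2)"
    using measure_pmf.variance_eq[OF i i, of "\<lambda>x. \<bar>f x\<bar>"]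
      measure_pmf.variance_positive[of p "\<lambda>x. \<bar>f x\<bar>"] by simp
qed

text \<open>The law that soft covering compares with the ideal one: a uniformly chosen codeword sent
  through \<open>W\<close>.\<close>

definition codebook_output :: "('u \<Rightarrow> 'y pmf) \<Rightarrow> 'u list \<Rightarrow> 'y \<Rightarrow> real" where
  "codebook_output W c y = (\<Sum>m<length c. pmf (W (c ! m)) y) / length c"

text \<open>Only the truncated part of the channel has controlled variance; the rest of its mass is the
  probability that the information density exceeds \<open>log \<gamma>\<close>.\<close>

lemma soft_covering_pointwise:
  fixes p :: "'u pmf" and W :: "'u \<Rightarrow> 'y pmf"
  assumes fin: "finite (set_pmf p)" and M: "M > 0" and \<gamma>: "\<gamma> \<ge> 0"
  defines "q \<equiv> bind_pmf p W"
  shows "E (iprod (\<lambda>_. p) M) (\<lambda>c. \<bar>codebook_output W c y - pmf q y\<bar>)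
       \<le> 2 * E p (\<lambda>u. if pmf (W u) y > \<gamma> * pmf q y then pmf (W u) y else 0) + sqrt (\<gamma> / M) * pmf q y"
proof -
  let ?C = "iprod (\<lambda>_. p) M"
  have finC: "finite (set_pmf ?C)" using fin by simp
  define Z where "Z u = (if pmf (W u) y > \<gamma> * pmf q y then pmf (W u) y else 0)" for u
  define X where "X u = pmf (W u) y - Z u" for u
  define \<mu> where "\<mu> = E p X"
  have Z0: "Z u \<ge> 0" for u by (simp add: Z_def)
  have X0: "X u \<ge> 0" and X1: "X u \<le> pmf (W u) y" and X2: "X u \<le> \<gamma> * pmf q y" for u
    using \<gamma> by (auto simp: X_def Z_def)
  have q: "pmf q y = E p (\<lambda>u. pmf (W u) y)" by (simp add: q_def pmf_bind)
  then have split: "pmf q y = \<mu> + E p Z"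
    unfolding \<mu>_def by (subst expectation_add_finite[OF fin, symmetric]) (simp add: X_def)
  let ?A = "\<lambda>f c. (\<Sum>m<M. f (c ! m)) / real M"
  have meanA: "E ?C (?A f) = E p f" for f
    using M by (simp add: expectation_sum_finite[OF finC] expectation_iprod_nth)
  have "E ?C (\<lambda>c. (?A X c - \<mu>)\<^sup>2) = E ?C (\<lambda>c. (\<Sum>m<M. (X (c ! m) - \<mu>) / M)\<^sup>2)"
    using M by (simp add: sum_divide_distrib[symmetric] sum_subtractf field_simps)
  also have "\<dots> = (\<Sum>m<M. E p (\<lambda>u. ((X u - \<mu>) / M)\<^sup>2))"
    by (rule iprod_second_moment) (use fin in \<open>auto simp: expectation_diff_finite \<mu>_def\<close>)
  also have "\<dots> = E p (\<lambda>u. (X u - \<mu>)\<^sup>2) / M"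
    using M by (simp add: power_divide power2_eq_square)
  also have "E p (\<lambda>u. (X u - \<mu>)\<^sup>2) \<le> E p (\<lambda>u. (X u)\<^sup>2)"
    unfolding \<mu>_def using fin
    by (subst measure_pmf.variance_eq) (auto intro: integrable_measure_pmf_finite)
  \<comment> \<open>One factor is bounded by the truncation level, the other by the channel, whose
    average is \<open>pmf q y\<close> again. The resulting square of \<open>pmf q y\<close> is what
    leaves, after the root, a bound that can be summed over \<open>y\<close>.\<close>
  also have "E p (\<lambda>u. (X u)\<^sup>2) \<le> E p (\<lambda>u. \<gamma> * pmf q y * pmf (W u) y)"
    by (rule expectation_mono_finite[OF fin])
      (use \<gamma> X0 X1 X2 in \<open>auto simp: power2_eq_square intro!: mult_mono\<close>)
  also have "\<dots> = \<gamma> * (pmf q y)\<^sup>2" by (simp add: q power2_eq_square)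
  finally have "E ?C (\<lambda>c. (?A X c - \<mu>)\<^sup>2) \<le> \<gamma> / M * (pmf q y)\<^sup>2"
    using M by (simp add: divide_right_mono)
  then have "sqrt (E ?C (\<lambda>c. (?A X c - \<mu>)\<^sup>2)) \<le> sqrt (\<gamma> / M) * pmf q y"
    by (metis real_sqrt_le_mono real_sqrt_mult real_sqrt_abs abs_of_nonneg pmf_nonneg)
  with expectation_abs_le_sqrt[OF finC, of "\<lambda>c. ?A X c - \<mu>"]
  have main: "E ?C (\<lambda>c. \<bar>?A X c - \<mu>\<bar>) \<le> sqrt (\<gamma> / M) * pmf q y" by linarith
  \<comment> \<open>The cut-off mass enters twice, as an average over the codebook and as its mean;
    hence the factor 2.\<close>
  have "E ?C (\<lambda>c. \<bar>codebook_output W c y - pmf q y\<bar>)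
      \<le> E ?C (\<lambda>c. \<bar>?A X c - \<mu>\<bar> + (?A Z c + E p Z))"
  proof (rule expectation_mono_finite[OF finC])
    fix c assume "c \<in> set_pmf ?C"
    then have "length c = M" by (rule length_iprod)
    then have "codebook_output W c y = ?A X c + ?A Z c"
      by (simp add: codebook_output_def X_def sum_subtractf add_divide_distrib[symmetric])
    moreover have "?A Z c \<ge> 0" "E p Z \<ge> 0"
      by (auto intro!: sum_nonneg divide_nonneg_nonneg integral_nonneg simp: Z0)
    ultimately show "\<bar>codebook_output W c y - pmf q y\<bar> \<le> \<bar>?A X c - \<mu>\<bar> + (?A Z c + E p Z)"
      using split by linarith
  qed
  also have "\<dots> = E ?C (\<lambda>c. \<bar>?A X c - \<mu>\<bar>) + (E p Z + E p Z)"
    using meanA[of Z] by (simp only: expectation_add_finite[OF finC] expectation_const)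
  finally show ?thesis
    using main unfolding Z_def[abs_def] by linarith
qed

lemma soft_covering_one_shot:
  fixes p :: "'u pmf" and W :: "'u \<Rightarrow> 'y pmf"
  assumes fin: "finite (set_pmf p)" and M: "M > 0" and \<gamma>: "\<gamma> \<ge> 0"
    and Y: "finite Y" "\<And>u. u \<in> set_pmf p \<Longrightarrow> set_pmf (W u) \<subseteq> Y"
  defines "q \<equiv> bind_pmf p W"
  shows "E (iprod (\<lambda>_. p) M) (\<lambda>c. \<Sum>y\<in>Y. \<bar>codebook_output W c y - pmf q y\<bar>)
       \<le> 2 * E p (\<lambda>u. E (W u) (\<lambda>y. of_bool (pmf (W u) y > \<gamma> * pmf q y))) + sqrt (\<gamma> / M)"
proof -
  have "E (iprod (\<lambda>_. p) M) (\<lambda>c. \<Sum>y\<in>Y. \<bar>codebook_output W c y - pmf q y\<bar>)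
      = (\<Sum>y\<in>Y. E (iprod (\<lambda>_. p) M) (\<lambda>c. \<bar>codebook_output W c y - pmf q y\<bar>))"
    using fin by (simp add: expectation_sum_finite)
  also have "\<dots> \<le> (\<Sum>y\<in>Y. 2 * E p (\<lambda>u. if pmf (W u) y > \<gamma> * pmf q y then pmf (W u) y else 0)
      + sqrt (\<gamma> / M) * pmf q y)"
    unfolding q_def by (intro sum_mono soft_covering_pointwise fin M \<gamma>)
  also have "\<dots> = 2 * (\<Sum>y\<in>Y. E p (\<lambda>u. if pmf (W u) y > \<gamma> * pmf q y then pmf (W u) y else 0))
      + sqrt (\<gamma> / M) * (\<Sum>y\<in>Y. pmf q y)"
    by (simp add: sum.distrib sum_distrib_left)
  also have "(\<Sum>y\<in>Y. pmf q y) = 1"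
    by (rule sum_pmf_eq_1) (use Y in \<open>auto simp: q_def\<close>)
  also have "(\<Sum>y\<in>Y. E p (\<lambda>u. if pmf (W u) y > \<gamma> * pmf q y then pmf (W u) y else 0))
      = E p (\<lambda>u. \<Sum>y\<in>Y. if pmf (W u) y > \<gamma> * pmf q y then pmf (W u) y else 0)"
    by (rule expectation_sum_finite[OF fin, symmetric])
  also have "\<dots> = E p (\<lambda>u. E (W u) (\<lambda>y. of_bool (pmf (W u) y > \<gamma> * pmf q y)))"
  proof (rule expectation_cong_pmf)
    fix u assume "u \<in> set_pmf p"
    then show "(\<Sum>y\<in>Y. if pmf (W u) y > \<gamma> * pmf q y then pmf (W u) y else 0)
        = E (W u) (\<lambda>y. of_bool (pmf (W u) y > \<gamma> * pmf q y))"
      by (subst expectation_sum_superset[OF Y]) (auto intro!: sum.cong)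
  qed
  finally show ?thesis by simp
qed

section \<open>Information density and its concentration\<close>

definition info_density :: "'u pmf \<Rightarrow> ('u \<Rightarrow> 'y pmf) \<Rightarrow> 'u \<times> 'y \<Rightarrow> real" where
  "info_density p W = (\<lambda>(u, y). log 2 (pmf (W u) y / pmf (bind_pmf p W) y))"

definition channel_joint :: "'u pmf \<Rightarrow> ('u \<Rightarrow> 'y pmf) \<Rightarrow> ('u \<times> 'y) pmf" where
  "channel_joint p W = bind_pmf p (\<lambda>u. map_pmf (Pair u) (W u))"

text \<open>The mutual information of input and output, written as the mean of the density because
  Chebyshev's inequality centres the density there.\<close>

definition channel_info :: "'u pmf \<Rightarrow> ('u \<Rightarrow> 'y pmf) \<Rightarrow> real" where
  "channel_info p W = E (channel_joint p W) (info_density p W)"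

text \<open>Chebyshev's inequality: the block density is a sum of independent letter densities whose
  means are the \<open>channel_info p (W i)\<close>, and the event asks it to exceed its mean by
  \<open>n * \<delta>\<close>.\<close>

lemma information_spectrum_tail:
  fixes p :: "'u::finite pmf" and W :: "nat \<Rightarrow> 'u \<Rightarrow> 'y::finite pmf" and \<delta> B :: real
  assumes \<delta>: "\<delta> > 0" and n: "n > 0"
    and B: "\<And>i. i < n \<Longrightarrow> E (channel_joint p (W i)) (\<lambda>x. (info_density p (W i) x - channel_info p (W i))\<^sup>2) \<le> B"
  defines "\<gamma> \<equiv> 2 powr ((\<Sum>i<n. channel_info p (W i)) + n * \<delta>)"
  defines "WW \<equiv> \<lambda>us. iprod (\<lambda>i. W i (us ! i)) n"
  defines "q \<equiv> bind_pmf (iprod (\<lambda>_. p) n) WW"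
  shows "E (iprod (\<lambda>_. p) n) (\<lambda>us. E (WW us) (\<lambda>y. of_bool (pmf (WW us) y > \<gamma> * pmf q y))) \<le> B / (n * \<delta>\<^sup>2)"
proof -
  let ?p = "iprod (\<lambda>_. p) n"
  have finp: "finite (set_pmf ?p)" and finW: "finite (set_pmf (WW us))" for us
    by (simp_all add: WW_def)
  have q: "q = iprod (\<lambda>i. bind_pmf p (W i)) n"
    unfolding q_def WW_def by (rule iprod_bind)
  define g where "g i x = info_density p (W i) x - channel_info p (W i)" for i x
  have "E ?p (\<lambda>us. E (WW us) (\<lambda>y. of_bool (pmf (WW us) y > \<gamma> * pmf q y)))
      \<le> E ?p (\<lambda>us. E (WW us) (\<lambda>ys. (\<Sum>i<n. g i (zip us ys ! i))\<^sup>2 / (n * \<delta>)\<^sup>2))"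
  proof (intro expectation_mono_finite finp finW)
    fix us ys assume us: "us \<in> set_pmf ?p" and ys: "ys \<in> set_pmf (WW us)"
    have len: "length us = n" "length ys = n"
      using us ys by (auto simp: WW_def dest: length_iprod)
    \<comment> \<open>On the support no factor is 0, so the logarithm of the product splits into
      letters.\<close>
    have pos: "pmf (W i (us ! i)) (ys ! i) > 0" "pmf (bind_pmf p (W i)) (ys ! i) > 0" if "i < n" for i
    proof -
      have 1: "us ! i \<in> set_pmf p" using us that by (rule iprod_nth_in)
      have 2: "ys ! i \<in> set_pmf (W i (us ! i))" using ys that unfolding WW_def by (rule iprod_nth_in)
      from 2 show "pmf (W i (us ! i)) (ys ! i) > 0" by (simp add: pmf_positive)
      from 1 2 show "pmf (bind_pmf p (W i)) (ys ! i) > 0" by (intro pmf_positive) auto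
    qed
    show "of_bool (pmf (WW us) ys > \<gamma> * pmf q ys) \<le> (\<Sum>i<n. g i (zip us ys ! i))\<^sup>2 / (n * \<delta>)\<^sup>2"
    proof (cases "pmf (WW us) ys > \<gamma> * pmf q ys")
      case True
      have "(\<Sum>i<n. info_density p (W i) (zip us ys ! i))
          = (\<Sum>i<n. log 2 (pmf (W i (us ! i)) (ys ! i) / pmf (bind_pmf p (W i)) (ys ! i)))"
        using len by (simp add: info_density_def)
      also have "\<dots> = log 2 (\<Prod>i<n. pmf (W i (us ! i)) (ys ! i) / pmf (bind_pmf p (W i)) (ys ! i))"
        unfolding log_def using pos[THEN less_imp_neq] by (subst ln_prod) (auto simp: sum_divide_distrib)
      also have "(\<Prod>i<n. pmf (W i (us ! i)) (ys ! i) / pmf (bind_pmf p (W i)) (ys ! i))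
          = pmf (WW us) ys / pmf q ys"
        using len by (simp add: WW_def q pmf_iprod prod_dividef)
      finally have 1: "(\<Sum>i<n. info_density p (W i) (zip us ys ! i)) = log 2 (pmf (WW us) ys / pmf q ys)" .
      have "pmf q ys > 0" using pos len by (auto simp: q pmf_iprod intro!: prod_pos)
      then have "\<gamma> < pmf (WW us) ys / pmf q ys" using True by (simp add: field_simps)
      then have "log 2 \<gamma> < log 2 (pmf (WW us) ys / pmf q ys)"
        by (subst log_less_cancel_iff) (auto simp: \<gamma>_def intro: less_trans[rotated])
      then have "n * \<delta> < (\<Sum>i<n. g i (zip us ys ! i))"
        unfolding 1[symmetric] by (simp add: \<gamma>_def g_def sum_subtractf)
      then have "(n * \<delta>)\<^sup>2 \<le> (\<Sum>i<n. g i (zip us ys ! i))\<^sup>2"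
        using \<delta> by (intro power_mono) auto
      then show ?thesis using True n \<delta> by (simp add: divide_simps)
    qed auto
  qed
  also have "\<dots> = E ?p (\<lambda>us. E (map_pmf (zip us) (WW us)) (\<lambda>xs. (\<Sum>i<n. g i (xs ! i))\<^sup>2)) / (n * \<delta>)\<^sup>2"
    by simp
  also have "E ?p (\<lambda>us. E (map_pmf (zip us) (WW us)) (\<lambda>xs. (\<Sum>i<n. g i (xs ! i))\<^sup>2))
      = E (iprod (\<lambda>i. channel_joint p (W i)) n) (\<lambda>xs. (\<Sum>i<n. g i (xs ! i))\<^sup>2)"
    unfolding channel_joint_def iprod_zip[symmetric] WW_def
    by (rule expectation_bind_finite[symmetric]) auto
  also have "\<dots> = (\<Sum>i<n. E (channel_joint p (W i)) (\<lambda>x. (g i x)\<^sup>2))"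
    by (rule iprod_second_moment) (auto simp: g_def expectation_diff_finite channel_info_def)
  also have "\<dots> \<le> n * B"
    using sum_bounded_above[of "{..<n}" _ B] B by (simp add: g_def)
  finally show ?thesis
    using n \<delta> by (simp add: divide_right_mono power2_eq_square field_simps)
qed

text \<open>Twice the total variation distance between the codebook output and the product law that
  fresh i.i.d. inputs would produce.\<close>

definition covering_gap ::
  "'u pmf \<Rightarrow> (nat \<Rightarrow> 'u \<Rightarrow> 'y::finite pmf) \<Rightarrow> nat \<Rightarrow> 'u list list \<Rightarrow> real" where
  "covering_gap p W n c = (\<Sum>y | length y = n.
     \<bar>codebook_output (\<lambda>us. iprod (\<lambda>i. W i (us ! i)) n) c y - pmf (iprod (\<lambda>i. bind_pmf p (W i)) n) y\<bar>)"

lemma finite_lists_length: "finite {y :: 'y::finite list. length y = n}"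
  using finite_lists_length_eq[of "UNIV :: 'y set" n] by simp

lemma soft_covering:
  fixes p :: "'u::finite pmf" and W :: "nat \<Rightarrow> 'u \<Rightarrow> 'y::finite pmf" and \<delta> B :: real
  assumes \<delta>: "\<delta> > 0" and n: "n > 0" and M: "M > 0"
    and B: "\<And>i. i < n \<Longrightarrow> E (channel_joint p (W i)) (\<lambda>x. (info_density p (W i) x - channel_info p (W i))\<^sup>2) \<le> B"
  shows "E (iprod (\<lambda>_. iprod (\<lambda>_. p) n) M) (covering_gap p W n)
    \<le> 2 * (B / (n * \<delta>\<^sup>2)) + sqrt (2 powr ((\<Sum>i<n. channel_info p (W i)) + n * \<delta>) / M)"
proof -
  let ?W = "\<lambda>us. iprod (\<lambda>i. W i (us ! i)) n"
  let ?\<gamma> = "2 powr ((\<Sum>i<n. channel_info p (W i)) + n * \<delta>)"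
  have "E (iprod (\<lambda>_. iprod (\<lambda>_. p) n) M) (covering_gap p W n)
     \<le> 2 * E (iprod (\<lambda>_. p) n) (\<lambda>us. E (?W us)
          (\<lambda>y. of_bool (pmf (?W us) y > ?\<gamma> * pmf (bind_pmf (iprod (\<lambda>_. p) n) ?W) y))) + sqrt (?\<gamma> / M)"
    unfolding covering_gap_def iprod_bind[symmetric]
    by (rule soft_covering_one_shot[OF _ M]) (auto simp: finite_lists_length dest: length_iprod)
  also have "\<dots> \<le> 2 * (B / (n * \<delta>\<^sup>2)) + sqrt (?\<gamma> / M)"
    using information_spectrum_tail[of \<delta> n p W B, OF \<delta> n B] by simp
  finally show ?thesis .
qed

section \<open>Player B's reaction to an open-loop strategy\<close>

text \<open>Player A's whole action sequence is fixed in advance, so only Player B's randomness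
  remains; entry \<open>i\<close> joins the history only after Player B's move at
  \<open>i\<close>.\<close>

fun react :: "('s list \<Rightarrow> ('a \<times> 'b) list \<Rightarrow> 'b pmf) \<Rightarrow> (nat \<Rightarrow> 's list \<Rightarrow> 's list) \<Rightarrow>
    's list \<Rightarrow> 'a list \<Rightarrow> nat \<Rightarrow> ('a \<times> 'b) list pmf" where
  "react gb bview ss as 0 = return_pmf []"
| "react gb bview ss as (Suc i) =
     bind_pmf (react gb bview ss as i) (\<lambda>h. map_pmf (\<lambda>b. h @ [(as ! i, b)]) (gb (bview i ss) h))"

definition reply :: "('s list \<Rightarrow> ('a \<times> 'b) list \<Rightarrow> 'b pmf) \<Rightarrow> (nat \<Rightarrow> 's list \<Rightarrow> 's list) \<Rightarrow>
    's list \<Rightarrow> 'a list \<Rightarrow> nat \<Rightarrow> 'b pmf" where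
  "reply gb bview ss as i = bind_pmf (react gb bview ss as i) (gb (bview i ss))"

lemma react_cong:
  assumes "\<And>j. j < i \<Longrightarrow> as ! j = as' ! j" "\<And>j. j < i \<Longrightarrow> bview j ss = bview j ss'"
  shows "react gb bview ss as i = react gb bview ss' as' i"
  using assms by (induction i) auto

text \<open>Causality with its offsets: the reply at \<open>i\<close> uses actions strictly before
  \<open>i\<close>, but also the view at \<open>i\<close> itself.\<close>

lemma reply_cong:
  assumes "\<And>j. j < i \<Longrightarrow> as ! j = as' ! j" "\<And>j. j \<le> i \<Longrightarrow> bview j ss = bview j ss'"
  shows "reply gb bview ss as i = reply gb bview ss' as' i"
proof -
  have "react gb bview ss as i = react gb bview ss' as' i"
    by (rule react_cong) (use assms in auto)
  then show ?thesis using assms(2)[of i] by (simp add: reply_def)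
qed

lemma length_react: "h \<in> set_pmf (react gb bview ss as i) \<Longrightarrow> length h = i"
  by (induction i arbitrary: h) auto

lemma finite_set_react [simp]:
  fixes gb :: "'s list \<Rightarrow> ('a \<times> 'b::finite) list \<Rightarrow> 'b pmf"
  shows "finite (set_pmf (react gb bview ss as i))"
  by (induction i) auto

text \<open>The first \<open>i\<close> rounds ignore entry \<open>i\<close> of the action sequence,
  so that entry can be redrawn at its turn. Drawing all actions beforehand therefore gives the same
  history law.\<close>

lemma play_open_loop:
  assumes fa: "\<And>past h. fa m past h = F (length h)" and "i \<le> n"
  shows "play fa gb bview m ss i = bind_pmf (iprod F n) (\<lambda>as. react gb bview ss as i)"
  using \<open>i \<le> n\<close>
proof (induction i)
  case (Suc i)
  then have i: "i < n" by simp
  have cut: "react gb bview ss (as[i := a]) i = react gb bview ss as i" for as a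
    by (rule react_cong) auto
  have "bind_pmf (iprod F n) (\<lambda>as. react gb bview ss as (Suc i)) =
      bind_pmf (iprod F n) (\<lambda>as. bind_pmf (F i) (\<lambda>a. react gb bview ss (as[i := a]) (Suc i)))"
    by (subst iprod_resample[OF i, symmetric]) (simp add: bind_assoc_pmf bind_map_pmf)
  also have "\<dots> = bind_pmf (iprod F n) (\<lambda>as. bind_pmf (F i) (\<lambda>a. bind_pmf (react gb bview ss as i)
      (\<lambda>h. map_pmf (\<lambda>b. h @ [(a, b)]) (gb (bview i ss) h))))"
    using i by (intro bind_pmf_cong refl) (auto simp: cut dest!: length_iprod)
  also have "\<dots> = bind_pmf (iprod F n) (\<lambda>as. bind_pmf (react gb bview ss as i) (\<lambda>h. bind_pmf (F i)
      (\<lambda>a. map_pmf (\<lambda>b. h @ [(a, b)]) (gb (bview i ss) h))))"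
    by (subst (2) bind_commute_pmf) (rule refl)
  also have "\<dots> = bind_pmf (iprod F n) (\<lambda>as. bind_pmf (react gb bview ss as i) (\<lambda>h. bind_pmf (F (length h))
      (\<lambda>a. map_pmf (\<lambda>b. h @ [(a, b)]) (gb (bview i ss) h))))"
    by (intro bind_pmf_cong refl) (auto dest!: length_react)
  also have "\<dots> = play fa gb bview m ss (Suc i)"
    using Suc by (simp add: fa bind_assoc_pmf map_pmf_def)
  finally show ?case ..
qed simp

lemma react_nth:
  "i < n \<Longrightarrow> map_pmf (\<lambda>h. h ! i) (react gb bview ss as n) = map_pmf (Pair (as ! i)) (reply gb bview ss as i)"
proof (induction n)
  case (Suc n)
  show ?case
  proof (cases "i = n")
    case True
    have "map_pmf (\<lambda>h. h ! i) (react gb bview ss as (Suc n)) =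
        bind_pmf (react gb bview ss as n) (\<lambda>h. map_pmf (\<lambda>b. (h @ [(as ! n, b)]) ! i) (gb (bview n ss) h))"
      by (simp add: map_bind_pmf map_pmf_comp)
    also have "\<dots> = bind_pmf (react gb bview ss as n) (\<lambda>h. map_pmf (Pair (as ! n)) (gb (bview n ss) h))"
      by (intro bind_pmf_cong refl) (auto dest!: length_react simp: True)
    finally show ?thesis by (simp add: True reply_def map_bind_pmf)
  next
    case False
    with Suc.prems have i: "i < n" by simp
    have "map_pmf (\<lambda>h. h ! i) (react gb bview ss as (Suc n)) =
        bind_pmf (react gb bview ss as n) (\<lambda>h. map_pmf (\<lambda>b. (h @ [(as ! n, b)]) ! i) (gb (bview n ss) h))"
      by (simp add: map_bind_pmf map_pmf_comp)
    also have "\<dots> = bind_pmf (react gb bview ss as n) (\<lambda>h. return_pmf (h ! i))"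
      using i by (intro bind_pmf_cong refl) (auto dest!: length_react simp: nth_append)
    finally show ?thesis using Suc.IH[OF i] by (simp add: map_pmf_def)
  qed
qed simp

text \<open>With Player B's randomness integrated out, the payoff is a fixed function of the
  state-action sequence, to which bounds between laws of that sequence apply.\<close>

definition stage_payoff :: "('a \<Rightarrow> 'b \<Rightarrow> 's \<Rightarrow> real) \<Rightarrow> ('s list \<Rightarrow> ('a \<times> 'b) list \<Rightarrow> 'b pmf) \<Rightarrow>
    (nat \<Rightarrow> 's list \<Rightarrow> 's list) \<Rightarrow> nat \<Rightarrow> ('s \<times> 'a) list \<Rightarrow> real" where
  "stage_payoff Pay gb bview i xs =
     E (reply gb bview (map fst xs) (map snd xs) i) (\<lambda>b. Pay (snd (xs ! i)) b (fst (xs ! i)))"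

lemma avg_payoff_open_loop:
  fixes pS :: "'s::finite pmf" and Pay :: "'a::finite \<Rightarrow> 'b::finite \<Rightarrow> 's \<Rightarrow> real"
  assumes enc: "\<And>ss. finite (set_pmf (enc ss))"
  shows "avg_payoff pS Pay bview n enc (\<lambda>m past h. F m (length h)) gb =
    E (iprod (\<lambda>_. pS) n) (\<lambda>ss. E (enc ss) (\<lambda>m. E (iprod (F m) n)
       (\<lambda>as. \<Sum>i<n. stage_payoff Pay gb bview i (zip ss as) / n)))"
proof -
  let ?fa = "\<lambda>m past h. F m (length h)"
  have play: "play ?fa gb bview m ss n = bind_pmf (iprod (F m) n) (\<lambda>as. react gb bview ss as n)" for m ss
    by (rule play_open_loop) auto
  have fin: "finite (set_pmf (iprod (F m) n))" "finite (set_pmf (iprod (\<lambda>_. pS) n))" for m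
    by auto
  have "avg_payoff pS Pay bview n enc ?fa gb =
     E (iprod (\<lambda>_. pS) n) (\<lambda>ss. E (enc ss) (\<lambda>m. E (iprod (F m) n) (\<lambda>as. E (react gb bview ss as n)
       (\<lambda>h. (\<Sum>i<n. Pay (fst (h ! i)) (snd (h ! i)) (ss ! i)) / n))))"
    unfolding avg_payoff_def iid_list_eq_iprod play
    by (simp add: expectation_bind_finite enc fin bind_assoc_pmf)
  also have "\<dots> = E (iprod (\<lambda>_. pS) n) (\<lambda>ss. E (enc ss) (\<lambda>m. E (iprod (F m) n)
       (\<lambda>as. \<Sum>i<n. stage_payoff Pay gb bview i (zip ss as) / n)))"
  proof (intro expectation_cong_pmf)
    fix ss m as assume "ss \<in> set_pmf (iprod (\<lambda>_. pS) n)" "as \<in> set_pmf (iprod (F m) n)"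
    then have len: "length ss = n" "length as = n" by (auto dest: length_iprod)
    have "E (react gb bview ss as n) (\<lambda>h. (\<Sum>i<n. Pay (fst (h ! i)) (snd (h ! i)) (ss ! i)) / n)
        = (\<Sum>i<n. E (map_pmf (\<lambda>h. h ! i) (react gb bview ss as n)) (\<lambda>x. Pay (fst x) (snd x) (ss ! i)) / n)"
      by (simp add: expectation_sum_finite sum_divide_distrib)
    also have "\<dots> = (\<Sum>i<n. stage_payoff Pay gb bview i (zip ss as) / n)"
      by (intro sum.cong refl) (auto simp: react_nth stage_payoff_def len)
    finally show "E (react gb bview ss as n) (\<lambda>h. (\<Sum>i<n. Pay (fst (h ! i)) (snd (h ! i)) (ss ! i)) / n)
        = (\<Sum>i<n. stage_payoff Pay gb bview i (zip ss as) / n)" .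
  qed
  finally show ?thesis .
qed

section \<open>Guaranteed payoffs\<close>

text \<open>The payoff \<open>g x b\<close> that the minimizer must concede when \<open>x\<close> has law \<open>q\<close> and only \<open>v x\<close> is
  revealed. A constant \<open>v\<close> models the uninformed Player B, \<open>v = fst\<close> the one who sees the state.\<close>

definition guarantee :: "('x \<Rightarrow> 'v) \<Rightarrow> ('x \<Rightarrow> 'b \<Rightarrow> real) \<Rightarrow> 'x pmf \<Rightarrow> real" where
  "guarantee v g q = (\<Sum>w\<in>UNIV. MIN b. \<Sum>x | v x = w. pmf q x * g x b)"

text \<open>Redraw entry \<open>i\<close> with the rest fixed. On a fibre of \<open>v\<close> the
  reply cannot depend on the redrawn entry, so it is a single mixed action there, which does no
  better for the minimizer than the best pure one.\<close>

lemma guarantee_le_expectation: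
  fixes q :: "nat \<Rightarrow> 'x::finite pmf" and g :: "'x \<Rightarrow> 'b::finite \<Rightarrow> real" and v :: "'x \<Rightarrow> 'v::finite"
  assumes i: "i < n"
    and inv: "\<And>xs x. length xs = n \<Longrightarrow> v x = v (xs ! i) \<Longrightarrow> \<pi> (xs[i := x]) = \<pi> xs"
  shows "guarantee v g (q i) \<le> E (iprod q n) (\<lambda>xs. E (\<pi> xs) (g (xs ! i)))"
proof -
  let ?Q = "iprod q n"
  have "guarantee v g (q i) = E ?Q (\<lambda>xs. guarantee v g (q i))" by simp
  also have "\<dots> \<le> E ?Q (\<lambda>xs. E (q i) (\<lambda>x. E (\<pi> (xs[i := x])) (g x)))"
  proof (rule expectation_mono_finite)
    fix xs assume "xs \<in> set_pmf ?Q"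
    then have len: "length xs = n" by (rule length_iprod)
    have "(MIN b. \<Sum>x | v x = w. pmf (q i) x * g x b)
        \<le> (\<Sum>x | v x = w. pmf (q i) x * E (\<pi> (xs[i := x])) (g x))" for w
    proof (cases "\<exists>x0. v x0 = w")
      case False
      then show ?thesis by simp
    next
      case True
      then obtain x0 where x0: "v x0 = w" by blast
      \<comment> \<open>\<open>x0\<close> represents the fibre; its reply serves every entry in
        it.\<close>
      have eq: "\<pi> (xs[i := x]) = \<pi> (xs[i := x0])" if "v x = w" for x
        using inv[of "xs[i := x0]" x] that x0 len i by simp
      have "(MIN b. \<Sum>x | v x = w. pmf (q i) x * g x b)
          = E (\<pi> (xs[i := x0])) (\<lambda>_. MIN b. \<Sum>x | v x = w. pmf (q i) x * g x b)" by simp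
      also have "\<dots> \<le> E (\<pi> (xs[i := x0])) (\<lambda>b. \<Sum>x | v x = w. pmf (q i) x * g x b)"
        by (rule expectation_mono_finite) (auto intro: Min_le)
      also have "\<dots> = (\<Sum>x | v x = w. pmf (q i) x * E (\<pi> (xs[i := x0])) (g x))"
        by (simp add: expectation_sum_finite)
      also have "\<dots> = (\<Sum>x | v x = w. pmf (q i) x * E (\<pi> (xs[i := x])) (g x))"
        using eq by (intro sum.cong refl) auto
      finally show ?thesis .
    qed
    then have "guarantee v g (q i) \<le> (\<Sum>w\<in>UNIV. \<Sum>x | v x = w. pmf (q i) x * E (\<pi> (xs[i := x])) (g x))"
      unfolding guarantee_def by (rule sum_mono)
    also have "\<dots> = E (q i) (\<lambda>x. E (\<pi> (xs[i := x])) (g x))"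
      using sum.group[of UNIV "UNIV :: 'v set" v "\<lambda>x. pmf (q i) x * E (\<pi> (xs[i := x])) (g x)"]
      by (simp add: expectation_sum_UNIV)
    finally show "guarantee v g (q i) \<le> E (q i) (\<lambda>x. E (\<pi> (xs[i := x])) (g x))" .
  qed auto
  also have "\<dots> = E ?Q (\<lambda>xs. E (map_pmf (\<lambda>x. xs[i := x]) (q i)) (\<lambda>xs. E (\<pi> xs) (g (xs ! i))))"
    using i by (intro expectation_cong_pmf) (auto dest!: length_iprod)
  also have "\<dots> = E (bind_pmf ?Q (\<lambda>xs. map_pmf (\<lambda>x. xs[i := x]) (q i))) (\<lambda>xs. E (\<pi> xs) (g (xs ! i)))"
    by (rule expectation_bind_finite[symmetric]) auto
  also have "\<dots> = E ?Q (\<lambda>xs. E (\<pi> xs) (g (xs ! i)))"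
    by (simp only: iprod_resample[OF i])
  finally show ?thesis .
qed

text \<open>Builds both the likelihood encoder and the reversed channel. The product form survives
  total weight 0: all weights then vanish and any point mass will do.\<close>

lemma normalize_weights:
  fixes w :: "'x \<Rightarrow> real"
  assumes "finite A" "A \<noteq> {}" "\<And>x. x \<in> A \<Longrightarrow> w x \<ge> 0"
  shows "\<exists>e. set_pmf e \<subseteq> A \<and> (\<forall>x\<in>A. w x = sum w A * pmf e x)"
proof (cases "sum w A = 0")
  case True
  obtain x where "x \<in> A" using assms by blast
  then show ?thesis using True assms
    by (intro exI[of _ "return_pmf x"]) (auto simp: sum_nonneg_eq_0_iff)
next
  case False
  define f where "f x = (if x \<in> A then w x / sum w A else 0)" for x
  have pos: "sum w A > 0" using False assms by (simp add: less_le sum_nonneg)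
  have f0: "f x \<ge> 0" for x using assms pos by (simp add: f_def)
  have "(\<integral>\<^sup>+ x. ennreal (f x) \<partial>count_space UNIV) = (\<Sum>x\<in>A. ennreal (f x))"
    by (rule nn_integral_count_space'[OF assms(1)]) (auto simp: f_def)
  also have "\<dots> = ennreal (\<Sum>x\<in>A. f x)" using f0 by simp
  also have "(\<Sum>x\<in>A. f x) = 1"
    using pos by (simp add: f_def sum_divide_distrib[symmetric])
  finally have *: "(\<integral>\<^sup>+ x. ennreal (f x) \<partial>count_space UNIV) = 1" by simp
  show ?thesis
    using pos by (intro exI[of _ "embed_pmf f"])
      (auto simp: pmf_embed_pmf[OF f0 *] set_embed_pmf[OF f0 *] f_def split: if_splits)
qed

text \<open>The error depends on \<open>f\<close> only through the bound \<open>K\<close>, hence is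
  the same for every strategy of Player B.\<close>

lemma sum_diff_le_gap:
  fixes a b f :: "'y \<Rightarrow> real"
  assumes "\<And>y. y \<in> Y \<Longrightarrow> \<bar>f y\<bar> \<le> K"
  shows "(\<Sum>y\<in>Y. b y * f y) - K * (\<Sum>y\<in>Y. \<bar>b y - a y\<bar>) \<le> (\<Sum>y\<in>Y. a y * f y)"
proof -
  have "(\<Sum>y\<in>Y. b y * f y) - (\<Sum>y\<in>Y. a y * f y) = (\<Sum>y\<in>Y. (b y - a y) * f y)"
    by (simp add: sum_subtractf left_diff_distrib)
  also have "\<dots> \<le> (\<Sum>y\<in>Y. K * \<bar>b y - a y\<bar>)"
  proof (rule sum_mono)
    fix y assume "y \<in> Y"
    have "(b y - a y) * f y \<le> \<bar>b y - a y\<bar> * \<bar>f y\<bar>" by (metis abs_ge_self abs_mult)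
    also have "\<dots> \<le> \<bar>b y - a y\<bar> * K" using assms[OF \<open>y \<in> Y\<close>] by (intro mult_left_mono) auto
    finally show "(b y - a y) * f y \<le> K * \<bar>b y - a y\<bar>" by (simp add: mult.commute)
  qed
  finally show ?thesis by (simp add: sum_distrib_left)
qed

section \<open>Payoff guaranteed by a codebook\<close>

lemma iprod_pair:
  fixes F :: "('x::finite \<times> 'y::finite) list \<Rightarrow> real"
  shows "E (iprod p n) (\<lambda>xs. E (iprod q n) (\<lambda>ys. F (zip xs ys))) = E (iprod (\<lambda>i. pair_pmf (p i) (q i)) n) F"
proof -
  have "iprod (\<lambda>i. pair_pmf (p i) (q i)) n = bind_pmf (iprod p n) (\<lambda>xs. map_pmf (zip xs) (iprod q n))"
    using iprod_zip[of p n "\<lambda>i _. q i"] by (simp add: pair_pmf_def map_pmf_def)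
  then show ?thesis by (simp add: expectation_bind_finite)
qed

lemma expectation_iprod_sum:
  fixes q :: "nat \<Rightarrow> 'x::finite pmf"
  shows "E (iprod q n) f = (\<Sum>x | length x = n. pmf (iprod q n) x * f x)"
  by (rule expectation_sum_superset) (auto simp: finite_lists_length dest: length_iprod)

lemma abs_stage_payoff_le:
  fixes Pay :: "'a \<Rightarrow> 'b::finite \<Rightarrow> 's \<Rightarrow> real"
  assumes "\<And>a b s. \<bar>Pay a b s\<bar> \<le> K"
  shows "\<bar>stage_payoff Pay gb bview i xs\<bar> \<le> K"
  unfolding stage_payoff_def by (rule abs_expectation_le) (use assms in auto)

text \<open>The encoder draws the message \<open>m\<close> with probability proportional to the likelihood of the
  state sequence under codeword \<open>m\<close>. The joint law of states and message is then, up to the first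
  covering gap, the one where \<open>m\<close> is uniform and the states pass through the reversed test channel.\<close>

lemma codebook_guarantee:
  fixes pU :: "'u::finite pmf" and pSU :: "'u \<Rightarrow> 's::finite pmf" and pAU :: "'u \<Rightarrow> 'a::finite pmf"
    and Pay :: "'a \<Rightarrow> 'b::finite \<Rightarrow> 's \<Rightarrow> real" and v :: "'s \<times> 'a \<Rightarrow> 'v::finite"
    and t :: "nat \<Rightarrow> 's \<times> 'a \<Rightarrow> 's \<times> 'a"
  assumes c: "length c > 0" and n: "n > 0" and k: "k \<le> n"
    and K: "\<And>a b s. \<bar>Pay a b s\<bar> \<le> K"
    and view: "\<And>i j xs x. j \<le> i \<Longrightarrow> i < length xs \<Longrightarrow> v x = v (xs ! i) \<Longrightarrow>
       bview j (map fst (xs[i := x])) = bview j (map fst xs)"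
    and view_t: "\<And>j xs. j < k \<Longrightarrow> length xs = n \<Longrightarrow>
       bview j (map fst (map (\<lambda>i. t i (xs ! i)) [0..<n])) = bview j (map fst xs)"
    and t_id: "\<And>i. i < k \<Longrightarrow> t i = id"
  defines "V \<equiv> \<lambda>u. pair_pmf (pSU u) (pAU u)"
  defines "g \<equiv> \<lambda>(s, a) b. Pay a b s"
  shows "\<exists>enc. (\<forall>ss. set_pmf (enc ss) \<subseteq> {..<length c}) \<and>
    (\<forall>gb. (k * guarantee v g (bind_pmf pU V)
         + (\<Sum>i=k..<n. (\<Sum>m<length c. guarantee v g (V (c ! m ! i))) / length c)) / n
         - K * covering_gap pU (\<lambda>_. pSU) n c - K * covering_gap pU (\<lambda>i u. map_pmf (t i) (V u)) n c
       \<le> avg_payoff (bind_pmf pU pSU) Pay bview n enc (\<lambda>m past h. pAU (c ! m ! length h)) gb)"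
proof -
  define M where "M = length c"
  let ?S = "\<lambda>m. iprod (\<lambda>i. pSU (c ! m ! i)) n"
  let ?X = "\<lambda>m. iprod (\<lambda>i. V (c ! m ! i)) n"
  let ?L = "{ss. length ss = n} :: 's list set"
  let ?LX = "{xs. length xs = n} :: ('s \<times> 'a) list set"
  let ?T = "\<lambda>xs. map (\<lambda>i. t i (xs ! i)) [0..<n]"
  let ?pS = "iprod (\<lambda>_. bind_pmf pU pSU) n"
  let ?g1 = "covering_gap pU (\<lambda>_. pSU) n c"
  let ?g2 = "covering_gap pU (\<lambda>i u. map_pmf (t i) (V u)) n c"
  define co where "co = codebook_output (\<lambda>us. iprod (\<lambda>i. pSU (us ! i)) n) c"
  define co2 where "co2 = codebook_output (\<lambda>us. iprod (\<lambda>i. map_pmf (t i) (V (us ! i))) n) c"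
  have M: "M > 0" using c by (simp add: M_def)
  have K0: "K \<ge> 0" using K[of undefined undefined undefined] by linarith
  have "\<forall>ss. \<exists>e. set_pmf e \<subseteq> {..<M} \<and>
      (\<forall>m\<in>{..<M}. pmf (?S m) ss = (\<Sum>m<M. pmf (?S m) ss) * pmf e m)"
    by (intro allI normalize_weights) (use M in auto)
  from choice[OF this] obtain enc where enc: "\<And>ss. set_pmf (enc ss) \<subseteq> {..<M}"
      and likelihood: "\<And>ss m. m < M \<Longrightarrow> pmf (?S m) ss = (\<Sum>m<M. pmf (?S m) ss) * pmf (enc ss) m"
    by blast
  have fin_enc: "finite (set_pmf (enc ss))" for ss
    using enc finite_subset by blast
  \<comment> \<open>The pivotal identity: the codebook output followed by the encoder is the joint
    law with uniform message. It holds also where every codeword has likelihood 0.\<close>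
  have bayes: "co ss * pmf (enc ss) m = pmf (?S m) ss / M" if "m < M" for ss m
    unfolding likelihood[OF that] by (simp add: co_def codebook_output_def M_def)
  have main: "(k * guarantee v g (bind_pmf pU V)
         + (\<Sum>i=k..<n. (\<Sum>m<M. guarantee v g (V (c ! m ! i))) / M)) / n - K * ?g1 - K * ?g2
       \<le> avg_payoff (bind_pmf pU pSU) Pay bview n enc (\<lambda>m past h. pAU (c ! m ! length h)) gb" for gb
  proof -
    define \<psi> where "\<psi> = stage_payoff Pay gb bview"
    have \<psi>K: "\<bar>\<psi> i xs\<bar> \<le> K" for i xs unfolding \<psi>_def by (rule abs_stage_payoff_le[OF K])
    define H where "H m ss = E (iprod (\<lambda>i. pAU (c ! m ! i)) n) (\<lambda>as. \<Sum>i<n. \<psi> i (zip ss as) / n)" for m ss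
    define G where "G ss = E (enc ss) (\<lambda>m. H m ss)" for ss
    have avg: "avg_payoff (bind_pmf pU pSU) Pay bview n enc (\<lambda>m past h. pAU (c ! m ! length h)) gb
        = (\<Sum>ss\<in>?L. pmf ?pS ss * G ss)"
      unfolding avg_payoff_open_loop[OF fin_enc, where F = "\<lambda>m j. pAU (c ! m ! j)"]
      by (simp add: expectation_iprod_sum G_def H_def \<psi>_def)
    have HK: "\<bar>H m ss\<bar> \<le> K" for m ss
      unfolding H_def
    proof (rule abs_expectation_le)
      fix as
      have "\<bar>\<Sum>i<n. \<psi> i (zip ss as) / n\<bar> \<le> (\<Sum>i<n. \<bar>\<psi> i (zip ss as) / n\<bar>)" by (rule sum_abs)
      also have "\<dots> \<le> (\<Sum>i<n. K / n)" using \<psi>K by (intro sum_mono) (auto simp: divide_right_mono)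
      finally show "\<bar>\<Sum>i<n. \<psi> i (zip ss as) / n\<bar> \<le> K" using n by simp
    qed auto
    have GK: "\<bar>G ss\<bar> \<le> K" for ss
      unfolding G_def using HK by (intro abs_expectation_le fin_enc)
    have "(\<Sum>ss\<in>?L. co ss * G ss) = (\<Sum>ss\<in>?L. \<Sum>m<M. co ss * pmf (enc ss) m * H m ss)"
      unfolding G_def expectation_sum_superset[OF finite_lessThan enc]
      by (simp add: sum_distrib_left mult.assoc)
    also have "\<dots> = (\<Sum>ss\<in>?L. \<Sum>m<M. pmf (?S m) ss / M * H m ss)"
      by (intro sum.cong refl) (simp add: bayes)
    also have "\<dots> = (\<Sum>m<M. E (?S m) (H m) / M)"
      by (subst sum.swap) (simp add: expectation_iprod_sum sum_divide_distrib)
    also have "\<dots> = (\<Sum>m<M. E (?X m) (\<lambda>xs. \<Sum>i<n. \<psi> i xs / n) / M)"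
      unfolding H_def V_def iprod_pair[where F = "\<lambda>xs. \<Sum>i<n. \<psi> i xs / n"] ..
    also have "\<dots> = (\<Sum>m<M. \<Sum>i<n. E (?X m) (\<psi> i) / n / M)"
      by (simp add: expectation_sum_finite sum_divide_distrib)
    also have "\<dots> = (\<Sum>i<n. \<Sum>m<M. E (?X m) (\<psi> i) / n / M)" by (rule sum.swap)
    also have "\<dots> = (\<Sum>i<n. (\<Sum>m<M. E (?X m) (\<psi> i)) / M) / n"
      by (simp add: sum_divide_distrib mult.commute)
    finally have Q: "(\<Sum>ss\<in>?L. co ss * G ss) = (\<Sum>i<n. (\<Sum>m<M. E (?X m) (\<psi> i)) / M) / n" .
    \<comment> \<open>The encoder and the play are the same under both state laws, so only the
      change in the law of the states is paid for.\<close>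
    have step1: "(\<Sum>i<n. (\<Sum>m<M. E (?X m) (\<psi> i)) / M) / n - K * ?g1
        \<le> avg_payoff (bind_pmf pU pSU) Pay bview n enc (\<lambda>m past h. pAU (c ! m ! length h)) gb"
      unfolding avg Q[symmetric] covering_gap_def co_def[symmetric]
      by (rule sum_diff_le_gap) (rule GK)
    \<comment> \<open>Valid for every product law \<open>q\<close>; it serves both the law given one
      codeword and the ideal i.i.d. law.\<close>
    have stage: "guarantee v g (q i) \<le> E (iprod q n) (\<psi> i)" if "i < n" for q i
    proof -
      let ?r = "\<lambda>xs. reply gb bview (map fst xs) (map snd xs) i"
      have "guarantee v g (q i) \<le> E (iprod q n) (\<lambda>xs. E (?r xs) (g (xs ! i)))"
      proof (rule guarantee_le_expectation[OF that])
        fix xs :: "('s \<times> 'a) list" and x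
        assume "length xs = n" "v x = v (xs ! i)"
        then show "?r (xs[i := x]) = ?r xs"
          using that by (intro reply_cong) (auto simp: view nth_list_update)
      qed
      also have "(\<lambda>xs. E (?r xs) (g (xs ! i))) = \<psi> i"
        by (simp add: \<psi>_def stage_payoff_def g_def fun_eq_iff case_prod_unfold)
      finally show ?thesis .
    qed
    \<comment> \<open>Given the message, the stages form a product law, so the stage bound applies
      message by message. This concedes the codeword to Player B.\<close>
    have late: "(\<Sum>m<M. guarantee v g (V (c ! m ! i))) / M \<le> (\<Sum>m<M. E (?X m) (\<psi> i)) / M" if "i < n" for i
      by (intro divide_right_mono sum_mono stage[OF that, of "\<lambda>i. V (c ! _ ! i)"]) auto
    \<comment> \<open>Here the mixture over messages is kept together and compared as a whole with
      the i.i.d. law.\<close>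
    have early: "guarantee v g (bind_pmf pU V) - K * ?g2 \<le> (\<Sum>m<M. E (?X m) (\<psi> i)) / M" if "i < k" for i
    proof -
      have i: "i < n" using that k by simp
      \<comment> \<open>Up to a stage \<open>i < k\<close>, the erasure alters neither the actions
        played nor Player B's views, so only the erased output has to be covered.\<close>
      have \<psi>T: "\<psi> i (?T xs) = \<psi> i xs" if "length xs = n" for xs
      proof -
        have "reply gb bview (map fst (?T xs)) (map snd (?T xs)) i = reply gb bview (map fst xs) (map snd xs) i"
          by (rule reply_cong) (use \<open>i < k\<close> i that in \<open>auto simp: t_id view_t simp del: map_map\<close>)
        moreover have "?T xs ! i = xs ! i" using \<open>i < k\<close> i by (simp add: t_id)
        ultimately show ?thesis by (simp only: \<psi>_def stage_payoff_def)
      qed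
      have ET: "E (iprod q n) (\<psi> i) = (\<Sum>xs\<in>?LX. pmf (iprod (\<lambda>i. map_pmf (t i) (q i)) n) xs * \<psi> i xs)" for q
      proof -
        have "E (iprod q n) (\<psi> i) = E (iprod q n) (\<lambda>xs. \<psi> i (?T xs))"
          by (intro expectation_cong_pmf \<psi>T[symmetric]) (rule length_iprod)
        also have "\<dots> = E (map_pmf ?T (iprod q n)) (\<psi> i)" by simp
        finally show ?thesis unfolding iprod_map_nth expectation_iprod_sum .
      qed
      have "(\<Sum>m<M. E (?X m) (\<psi> i)) / M = (\<Sum>xs\<in>?LX. co2 xs * \<psi> i xs)"
        unfolding ET co2_def codebook_output_def M_def
        by (subst sum.swap) (simp add: sum_divide_distrib sum_distrib_right)
      moreover have "guarantee v g (bind_pmf pU V)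
          \<le> (\<Sum>xs\<in>?LX. pmf (iprod (\<lambda>i. bind_pmf pU (\<lambda>u. map_pmf (t i) (V u))) n) xs * \<psi> i xs)"
        using stage[OF i, of "\<lambda>_. bind_pmf pU V"] unfolding ET by (simp add: map_bind_pmf)
      moreover have "(\<Sum>xs\<in>?LX. pmf (iprod (\<lambda>i. bind_pmf pU (\<lambda>u. map_pmf (t i) (V u))) n) xs * \<psi> i xs) - K * ?g2
          \<le> (\<Sum>xs\<in>?LX. co2 xs * \<psi> i xs)"
        unfolding covering_gap_def co2_def[symmetric]
        by (subst abs_minus_commute, rule sum_diff_le_gap) (rule \<psi>K)
      ultimately show ?thesis by linarith
    qed
    have g2: "?g2 \<ge> 0" by (simp add: covering_gap_def sum_nonneg)
    \<comment> \<open>The second gap arises in \<open>k\<close> iterations but is charged for all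
      \<open>n\<close>, so that division by \<open>n\<close> leaves \<open>K\<close> times the
      gap.\<close>
    have "k * guarantee v g (bind_pmf pU V) - K * ?g2 * n
         + (\<Sum>i=k..<n. (\<Sum>m<M. guarantee v g (V (c ! m ! i))) / M)
       \<le> (\<Sum>i<k. guarantee v g (bind_pmf pU V) - K * ?g2)
         + (\<Sum>i=k..<n. (\<Sum>m<M. guarantee v g (V (c ! m ! i))) / M)"
      using k K0 g2 mult_left_mono[of "real k" "real n" "K * ?g2"] by (simp add: algebra_simps)
    also have "\<dots> \<le> (\<Sum>i<k. (\<Sum>m<M. E (?X m) (\<psi> i)) / M) + (\<Sum>i=k..<n. (\<Sum>m<M. E (?X m) (\<psi> i)) / M)"
      by (intro add_mono sum_mono early late) auto
    also have "\<dots> = (\<Sum>i<n. (\<Sum>m<M. E (?X m) (\<psi> i)) / M)"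
      using sum.atLeastLessThan_concat[of 0 k n "\<lambda>i. (\<Sum>m<M. E (?X m) (\<psi> i)) / M"] k
      by (simp add: atLeast0LessThan)
    finally have "(k * guarantee v g (bind_pmf pU V) - K * ?g2 * n
         + (\<Sum>i=k..<n. (\<Sum>m<M. guarantee v g (V (c ! m ! i))) / M)) / n
       \<le> (\<Sum>i<n. (\<Sum>m<M. E (?X m) (\<psi> i)) / M) / n"
      by (rule divide_right_mono) simp
    with step1 n show ?thesis
      by (simp add: add_divide_distrib diff_divide_distrib)
  qed
  show ?thesis
    using enc main by (intro exI[of _ enc]) (auto simp: M_def)
qed

section \<open>Mutual information of channels\<close>

lemma pmf_bind_sum_UNIV:
  fixes p :: "'u::finite pmf"
  shows "pmf (bind_pmf p W) y = (\<Sum>u\<in>UNIV. pmf p u * pmf (W u) y)"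
  by (simp add: pmf_bind expectation_sum_UNIV)

lemma pmf_bind_pos: "pmf p u > 0 \<Longrightarrow> pmf (W u) y > 0 \<Longrightarrow> pmf (bind_pmf p W) y > 0"
  unfolding pmf_positive_iff set_bind_pmf by blast

lemma sum_pmf_UNIV [simp]:
  fixes p :: "'u::finite pmf"
  shows "(\<Sum>u\<in>UNIV. pmf p u) = 1"
  by (rule sum_pmf_eq_1) auto

lemma sum_UNIV_pair:
  "(\<Sum>x\<in>UNIV. f x) = (\<Sum>a\<in>UNIV. \<Sum>b\<in>UNIV. f (a, b))"
  for f :: "'a::finite \<times> 'b::finite \<Rightarrow> real"
  by (simp add: sum.cartesian_product)

lemma channel_info_sum:
  fixes p :: "'u::finite pmf" and W :: "'u \<Rightarrow> 'y::finite pmf"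
  shows "channel_info p W = (\<Sum>u\<in>UNIV. \<Sum>y\<in>UNIV.
    pmf p u * pmf (W u) y * log 2 (pmf (W u) y / pmf (bind_pmf p W) y))"
proof -
  have "channel_info p W = E p (\<lambda>u. E (W u) (\<lambda>y. info_density p W (u, y)))"
    unfolding channel_info_def channel_joint_def by (subst expectation_bind_finite) auto
  then show ?thesis
    by (simp add: expectation_sum_UNIV info_density_def sum_distrib_left mult.assoc)
qed

lemma mutual_info_eq_channel_info:
  fixes p :: "'u::finite pmf" and W :: "'u \<Rightarrow> 'y::finite pmf"
  assumes J: "\<And>u y. J (u, y) = pmf p u * pmf (W u) y"
  shows "mutual_info J = channel_info p W"
  unfolding mutual_info_def channel_info_sum sum_UNIV_pair case_prod_conv J
    pmf_bind_sum_UNIV[symmetric] sum_distrib_left[symmetric] sum_pmf_UNIV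
  by (intro sum.cong refl) auto

text \<open>Gibbs' inequality: by \<open>ln x \<le> x - 1\<close> each term dominates the matching
  term of a sum that telescopes to 0 because \<open>W u\<close> and the output law both have mass
  1.\<close>

lemma channel_info_nonneg:
  fixes p :: "'u::finite pmf" and W :: "'u \<Rightarrow> 'y::finite pmf"
  shows "channel_info p W \<ge> 0"
proof -
  let ?q = "bind_pmf p W"
  have "(\<Sum>u\<in>UNIV. \<Sum>y\<in>UNIV. pmf p u * (pmf (W u) y - pmf ?q y)) = 0"
    by (simp add: sum_distrib_left[symmetric] sum_subtractf)
  then have "0 = (\<Sum>u\<in>UNIV. \<Sum>y\<in>UNIV. pmf p u * (pmf (W u) y - pmf ?q y) / ln 2)"
    by (simp add: sum_divide_distrib[symmetric])
  also have "\<dots> \<le> channel_info p W"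
    unfolding channel_info_sum
  proof (intro sum_mono)
    fix u y
    show "pmf p u * (pmf (W u) y - pmf ?q y) / ln 2
        \<le> pmf p u * pmf (W u) y * log 2 (pmf (W u) y / pmf ?q y)"
    proof (cases "pmf p u = 0 \<or> pmf (W u) y = 0")
      case True
      then show ?thesis by (auto simp: field_simps)
    next
      case False
      then have pos: "pmf p u > 0" "pmf (W u) y > 0" by (auto simp: less_le)
      then have q: "pmf ?q y > 0" by (rule pmf_bind_pos)
      have "ln (pmf ?q y / pmf (W u) y) \<le> pmf ?q y / pmf (W u) y - 1"
        using pos q by (intro ln_le_minus_one) auto
      then have "pmf (W u) y * (1 - pmf ?q y / pmf (W u) y) \<le> pmf (W u) y * ln (pmf (W u) y / pmf ?q y)"
        using pos q by (intro mult_left_mono) (auto simp: ln_div)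
      then have "pmf (W u) y - pmf ?q y \<le> pmf (W u) y * ln (pmf (W u) y / pmf ?q y)"
        using pos by (simp add: right_diff_distrib)
      then have "pmf p u * (pmf (W u) y - pmf ?q y) / ln 2
          \<le> pmf p u * (pmf (W u) y * ln (pmf (W u) y / pmf ?q y)) / ln 2"
        by (intro divide_right_mono mult_left_mono) auto
      then show ?thesis by (simp add: log_def)
    qed
  qed
  finally show ?thesis .
qed

lemma channel_info_const: "channel_info p (\<lambda>_. q) = 0"
proof -
  have "E (channel_joint p (\<lambda>_. q)) (info_density p (\<lambda>_. q)) = E (channel_joint p (\<lambda>_. q)) (\<lambda>_. 0)"
    by (rule expectation_cong_pmf) (auto simp: channel_joint_def info_density_def set_pmf_iff)
  then show ?thesis by (simp add: channel_info_def)
qed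

text \<open>Applied to \<open>\<lambda>s. (s, undefined)\<close>: a blanked action leaves the
  information of the bare state.\<close>

lemma channel_info_map_inj:
  assumes f: "inj f"
  shows "channel_info p (\<lambda>u. map_pmf f (W u)) = channel_info p W"
proof -
  have *: "channel_joint p (\<lambda>u. map_pmf f (W u)) = map_pmf (map_prod id f) (channel_joint p W)"
    by (simp add: channel_joint_def map_bind_pmf map_pmf_comp)
  have "info_density p (\<lambda>u. map_pmf f (W u)) (map_prod id f x) = info_density p W x" for x
    using f by (cases x) (simp add: info_density_def pmf_map_inj' flip: map_bind_pmf)
  then show ?thesis by (simp add: channel_info_def *)
qed

text \<open>By the Markov chain S - U - A the quantity is the mean over \<open>s\<close> of
  \<open>channel_info (pUS s) pAU\<close>.\<close>

lemma cond_mutual_info_nonneg: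
  fixes pS :: "'s::finite pmf" and pUS :: "'s \<Rightarrow> 'u::finite pmf" and pAU :: "'u \<Rightarrow> 'a::finite pmf"
  shows "cond_mutual_info (\<lambda>(u, a, s). joint_SUA pS pUS pAU s u a) \<ge> 0"
proof -
  let ?A = "\<lambda>s. bind_pmf (pUS s) pAU"
  have 1: "(\<Sum>u\<in>UNIV. pmf pS s * pmf (pUS s) u) = pmf pS s" for s
    by (simp add: sum_distrib_left[symmetric])
  have 2: "(\<Sum>a\<in>UNIV. pmf pS s * pmf (pUS s) u * pmf (pAU u) a) = pmf pS s * pmf (pUS s) u" for s u
    by (simp add: sum_distrib_left[symmetric])
  have 3: "(\<Sum>u\<in>UNIV. pmf pS s * pmf (pUS s) u * pmf (pAU u) a) = pmf pS s * pmf (?A s) a" for s a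
    by (simp add: pmf_bind_sum_UNIV sum_distrib_left mult.assoc)
  have "cond_mutual_info (\<lambda>(u, a, s). joint_SUA pS pUS pAU s u a) =
      (\<Sum>u\<in>UNIV. \<Sum>a\<in>UNIV. \<Sum>s\<in>UNIV.
        pmf pS s * (pmf (pUS s) u * pmf (pAU u) a * log 2 (pmf (pAU u) a / pmf (?A s) a)))"
    unfolding cond_mutual_info_def sum_UNIV_pair case_prod_conv joint_SUA_def 1 2 3
    by (intro sum.cong refl) auto
  also have "\<dots> = (\<Sum>u\<in>UNIV. \<Sum>s\<in>UNIV. \<Sum>a\<in>UNIV.
        pmf pS s * (pmf (pUS s) u * pmf (pAU u) a * log 2 (pmf (pAU u) a / pmf (?A s) a)))"
    by (intro sum.cong refl sum.swap)
  also have "\<dots> = (\<Sum>s\<in>UNIV. \<Sum>u\<in>UNIV. \<Sum>a\<in>UNIV.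
        pmf pS s * (pmf (pUS s) u * pmf (pAU u) a * log 2 (pmf (pAU u) a / pmf (?A s) a)))"
    by (rule sum.swap)
  also have "\<dots> = (\<Sum>s\<in>UNIV. pmf pS s * channel_info (pUS s) pAU)"
    by (simp add: channel_info_sum sum_distrib_left)
  finally show ?thesis by (simp add: sum_nonneg channel_info_nonneg)
qed

text \<open>On the support the likelihood ratio of (s, a) factors into that of \<open>s\<close> and
  a conditional one, seen by multiplying and dividing by \<open>pmf ?S s\<close>.\<close>

lemma mutual_info_chain_rule:
  fixes pU :: "'u::finite pmf" and pSU :: "'u \<Rightarrow> 's::finite pmf" and pAU :: "'u \<Rightarrow> 'a::finite pmf"
  assumes J: "\<And>u a s. J (u, a, s) = pmf pU u * pmf (pSU u) s * pmf (pAU u) a"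
  shows "channel_info pU (\<lambda>u. pair_pmf (pSU u) (pAU u)) = channel_info pU pSU + cond_mutual_info J"
proof -
  let ?V = "\<lambda>u. pair_pmf (pSU u) (pAU u)"
  let ?S = "bind_pmf pU pSU" and ?SA = "bind_pmf pU ?V"
  have 1: "(\<Sum>u\<in>UNIV. pmf pU u * pmf (pSU u) s) = pmf ?S s" for s
    by (simp add: pmf_bind_sum_UNIV)
  have 2: "(\<Sum>a\<in>UNIV. J (u, a, s)) = pmf pU u * pmf (pSU u) s" for u s
    by (simp add: J sum_distrib_left[symmetric])
  have 3: "(\<Sum>u\<in>UNIV. J (u, a, s)) = pmf ?SA (s, a)" for s a
    by (simp add: J pmf_bind_sum_UNIV pmf_pair mult.assoc)
  have "channel_info pU pSU = (\<Sum>u\<in>UNIV. \<Sum>s\<in>UNIV.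
      (\<Sum>a\<in>UNIV. J (u, a, s)) * log 2 (pmf (pSU u) s / pmf ?S s))"
    by (simp add: channel_info_sum 2)
  also have "\<dots> = (\<Sum>u\<in>UNIV. \<Sum>a\<in>UNIV. \<Sum>s\<in>UNIV. J (u, a, s) * log 2 (pmf (pSU u) s / pmf ?S s))"
    unfolding sum_distrib_right by (intro sum.cong refl sum.swap)
  finally have S: "channel_info pU pSU = \<dots>" .
  have "channel_info pU ?V = (\<Sum>u\<in>UNIV. \<Sum>s\<in>UNIV. \<Sum>a\<in>UNIV.
      J (u, a, s) * log 2 (pmf (pSU u) s * pmf (pAU u) a / pmf ?SA (s, a)))"
    by (simp add: channel_info_sum sum_UNIV_pair pmf_pair J mult.assoc)
  also have "\<dots> = (\<Sum>u\<in>UNIV. \<Sum>a\<in>UNIV. \<Sum>s\<in>UNIV.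
      J (u, a, s) * log 2 (pmf (pSU u) s * pmf (pAU u) a / pmf ?SA (s, a)))"
    by (intro sum.cong refl sum.swap)
  also have "\<dots> = (\<Sum>u\<in>UNIV. \<Sum>a\<in>UNIV. \<Sum>s\<in>UNIV. J (u, a, s) * log 2 (pmf (pSU u) s / pmf ?S s)
      + (if J (u, a, s) = 0 then 0 else J (u, a, s) * log 2 (J (u, a, s) * pmf ?S s /
          (pmf pU u * pmf (pSU u) s * pmf ?SA (s, a)))))"
  proof (intro sum.cong refl)
    fix u a s
    show "J (u, a, s) * log 2 (pmf (pSU u) s * pmf (pAU u) a / pmf ?SA (s, a)) =
      J (u, a, s) * log 2 (pmf (pSU u) s / pmf ?S s)
      + (if J (u, a, s) = 0 then 0 else J (u, a, s) * log 2 (J (u, a, s) * pmf ?S s /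
          (pmf pU u * pmf (pSU u) s * pmf ?SA (s, a))))"
    proof (cases "J (u, a, s) = 0")
      case False
      then have pos: "pmf pU u > 0" "pmf (pSU u) s > 0" "pmf (pAU u) a > 0"
        by (auto simp: J less_le)
      have S0: "pmf ?S s > 0" using pos(1,2) by (rule pmf_bind_pos)
      have SA0: "pmf ?SA (s, a) > 0"
        using pos by (intro pmf_bind_pos[of pU u]) (auto simp: pmf_pair)
      have "log 2 (pmf (pSU u) s * pmf (pAU u) a / pmf ?SA (s, a)) =
          log 2 (pmf (pSU u) s / pmf ?S s * (pmf (pAU u) a * pmf ?S s / pmf ?SA (s, a)))"
        using S0 by (simp add: field_simps)
      also have "\<dots> = log 2 (pmf (pSU u) s / pmf ?S s) + log 2 (pmf (pAU u) a * pmf ?S s / pmf ?SA (s, a))"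
        using pos S0 SA0 by (subst log_mult) auto
      finally show ?thesis using pos by (simp add: J distrib_left)
    qed simp
  qed
  also have "\<dots> = channel_info pU pSU + cond_mutual_info J"
    unfolding S cond_mutual_info_def sum_UNIV_pair case_prod_conv 1 2 3
    by (simp only: sum.distrib)
  finally show ?thesis .
qed

section \<open>Single-letter guarantees\<close>

text \<open>A minimizing pure action is picked in each fibre; together they form one deterministic
  strategy, to be compared with infima over mixed strategies.\<close>

lemma guarantee_attained:
  fixes q :: "'x::finite pmf" and g :: "'x \<Rightarrow> 'b::finite \<Rightarrow> real" and v :: "'x \<Rightarrow> 'v::finite"
  shows "\<exists>\<beta>. guarantee v g q = (\<Sum>x\<in>UNIV. pmf q x * g x (\<beta> (v x)))"
proof -
  have "\<forall>w. \<exists>b. (MIN b. \<Sum>x | v x = w. pmf q x * g x b) = (\<Sum>x | v x = w. pmf q x * g x b)"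
  proof
    fix w
    have "(MIN b. \<Sum>x | v x = w. pmf q x * g x b) \<in> range (\<lambda>b. \<Sum>x | v x = w. pmf q x * g x b)"
      by (rule Min_in) auto
    then show "\<exists>b. (MIN b. \<Sum>x | v x = w. pmf q x * g x b) = (\<Sum>x | v x = w. pmf q x * g x b)"
      by (rule rangeE) blast
  qed
  from choice[OF this] obtain \<beta> where
    \<beta>: "\<And>w. (MIN b. \<Sum>x | v x = w. pmf q x * g x b) = (\<Sum>x | v x = w. pmf q x * g x (\<beta> w))" by blast
  have "guarantee v g q = (\<Sum>w\<in>UNIV. \<Sum>x | v x = w. pmf q x * g x (\<beta> (v x)))"
    unfolding guarantee_def \<beta> by (intro sum.cong refl) auto
  also have "\<dots> = (\<Sum>x\<in>UNIV. pmf q x * g x (\<beta> (v x)))"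
    using sum.group[of UNIV "UNIV :: 'v set" v "\<lambda>x. pmf q x * g x (\<beta> (v x))"] by simp
  finally show ?thesis by blast
qed

lemma sum_pmf_return: "(\<Sum>b\<in>UNIV. pmf (return_pmf x) b * f b) = f x"
  for f :: "'b::finite \<Rightarrow> real"
  using expectation_sum_UNIV[of "return_pmf x" f] by simp

lemma weighted_ge: "0 \<le> w \<Longrightarrow> w \<le> 1 \<Longrightarrow> - \<bar>x\<bar> \<le> w * x" for w x :: real
  using mult_right_mono[of w 1 "\<bar>x\<bar>"] abs_ge_minus_self[of "w * x"] by (simp add: abs_mult)

text \<open>Boundedness licenses comparing a real infimum with a single strategy. The parameter
  \<open>pB\<close> covers strategies with and without knowledge of the state.\<close>

lemma bdd_below_payoff3:
  fixes Pay :: "'a::finite \<Rightarrow> 'b::finite \<Rightarrow> 's::finite \<Rightarrow> real"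
  shows "bdd_below (range (\<lambda>\<beta>. \<Sum>a\<in>UNIV. \<Sum>b\<in>UNIV. \<Sum>s\<in>UNIV.
    pmf pS s * pmf (pAS s) a * pmf (pB \<beta> s) b * Pay a b s))"
  by (rule bdd_belowI2[where m = "\<Sum>a\<in>UNIV. \<Sum>b\<in>UNIV. \<Sum>s\<in>UNIV. - \<bar>Pay a b s\<bar>"])
     (intro sum_mono weighted_ge mult_nonneg_nonneg mult_le_one pmf_nonneg pmf_le_1)

lemma bdd_below_payoff4:
  fixes Pay :: "'a::finite \<Rightarrow> 'b::finite \<Rightarrow> 's::finite \<Rightarrow> real" and pUS :: "'s \<Rightarrow> 'u::finite pmf"
  shows "bdd_below (range (\<lambda>\<beta>. \<Sum>a\<in>UNIV. \<Sum>b\<in>UNIV. \<Sum>s\<in>UNIV. \<Sum>u\<in>UNIV.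
    pmf pS s * pmf (pUS s) u * pmf (pAU u) a * pmf (pB \<beta> s u) b * Pay a b s))"
  by (rule bdd_belowI2[where m = "\<Sum>a\<in>UNIV. \<Sum>b\<in>UNIV. \<Sum>s\<in>UNIV. \<Sum>u\<in>(UNIV::'u set). - \<bar>Pay a b s\<bar>"])
     (intro sum_mono weighted_ge mult_nonneg_nonneg mult_le_one pmf_nonneg pmf_le_1)

lemma payoff3_pure:
  fixes Pay :: "'a::finite \<Rightarrow> 'b::finite \<Rightarrow> 's::finite \<Rightarrow> real"
  assumes "\<And>s a. pmf q (s, a) = pmf pS s * pmf (pAS s) a"
  shows "(\<Sum>a\<in>UNIV. \<Sum>b\<in>UNIV. \<Sum>s\<in>UNIV. pmf pS s * pmf (pAS s) a * pmf (return_pmf (\<beta> s)) b * Pay a b s)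
    = (\<Sum>x\<in>UNIV. pmf q x * (case x of (s, a) \<Rightarrow> \<lambda>b. Pay a b s) (\<beta> (fst x)))"
proof -
  have "(\<Sum>b\<in>UNIV. \<Sum>s\<in>UNIV. pmf pS s * pmf (pAS s) a * pmf (return_pmf (\<beta> s)) b * Pay a b s)
      = (\<Sum>s\<in>UNIV. pmf pS s * pmf (pAS s) a * Pay a (\<beta> s) s)" for a
    by (subst sum.swap) (simp only: mult.assoc sum_distrib_left[symmetric] sum_pmf_return)
  then have "(\<Sum>a\<in>UNIV. \<Sum>b\<in>UNIV. \<Sum>s\<in>UNIV. pmf pS s * pmf (pAS s) a * pmf (return_pmf (\<beta> s)) b * Pay a b s)
      = (\<Sum>a\<in>UNIV. \<Sum>s\<in>UNIV. pmf pS s * pmf (pAS s) a * Pay a (\<beta> s) s)" by (simp only:)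
  also have "\<dots> = (\<Sum>s\<in>UNIV. \<Sum>a\<in>UNIV. pmf pS s * pmf (pAS s) a * Pay a (\<beta> s) s)" by (rule sum.swap)
  finally show ?thesis by (simp add: sum_UNIV_pair assms)
qed

lemma payoff4_pure:
  fixes Pay :: "'a::finite \<Rightarrow> 'b::finite \<Rightarrow> 's::finite \<Rightarrow> real" and pU :: "'u::finite pmf"
  assumes bayes: "\<And>u s. pmf pU u * pmf (pSU u) s = pmf pS s * pmf (pUS s) u"
  shows "(\<Sum>a\<in>UNIV. \<Sum>b\<in>UNIV. \<Sum>s\<in>UNIV. \<Sum>u\<in>UNIV.
      pmf pS s * pmf (pUS s) u * pmf (pAU u) a * pmf (return_pmf (\<beta> s u)) b * Pay a b s)
    = E pU (\<lambda>u. \<Sum>x\<in>UNIV. pmf (pair_pmf (pSU u) (pAU u)) x * (case x of (s, a) \<Rightarrow> \<lambda>b. Pay a b s) (\<beta> (fst x) u))"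
proof -
  let ?F = "\<lambda>a b s u. pmf pS s * pmf (pUS s) u * pmf (pAU u) a * pmf (return_pmf (\<beta> s u)) b * Pay a b s"
  have "(\<Sum>a\<in>UNIV. \<Sum>b\<in>UNIV. \<Sum>s\<in>UNIV. \<Sum>u\<in>UNIV. ?F a b s u)
      = (\<Sum>a\<in>UNIV. \<Sum>s\<in>UNIV. \<Sum>b\<in>UNIV. \<Sum>u\<in>UNIV. ?F a b s u)"
    by (intro sum.cong refl sum.swap)
  also have "\<dots> = (\<Sum>a\<in>UNIV. \<Sum>s\<in>UNIV. \<Sum>u\<in>UNIV. \<Sum>b\<in>UNIV. ?F a b s u)"
    by (intro sum.cong refl sum.swap)
  also have "\<dots> = (\<Sum>a\<in>UNIV. \<Sum>s\<in>UNIV. \<Sum>u\<in>UNIV. pmf pS s * pmf (pUS s) u * pmf (pAU u) a * Pay a (\<beta> s u) s)"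
    by (simp only: mult.assoc sum_distrib_left[symmetric] sum_pmf_return)
  also have "\<dots> = (\<Sum>s\<in>UNIV. \<Sum>a\<in>UNIV. \<Sum>u\<in>UNIV. pmf pS s * pmf (pUS s) u * pmf (pAU u) a * Pay a (\<beta> s u) s)"
    by (rule sum.swap)
  also have "\<dots> = (\<Sum>s\<in>UNIV. \<Sum>u\<in>UNIV. \<Sum>a\<in>UNIV. pmf pS s * pmf (pUS s) u * pmf (pAU u) a * Pay a (\<beta> s u) s)"
    by (intro sum.cong refl sum.swap)
  also have "\<dots> = (\<Sum>u\<in>UNIV. \<Sum>s\<in>UNIV. \<Sum>a\<in>UNIV. pmf pS s * pmf (pUS s) u * pmf (pAU u) a * Pay a (\<beta> s u) s)"
    by (rule sum.swap)
  finally show ?thesis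
    by (simp add: expectation_sum_UNIV sum_UNIV_pair pmf_pair bayes[symmetric] sum_distrib_left mult.assoc)
qed

text \<open>The pure minimizer behind \<open>guarantee\<close> takes part in the infimum, which
  gives the direction that a lower bound on the payoff requires.\<close>

lemma lowPi_le_guarantee:
  fixes Pay :: "'a::finite \<Rightarrow> 'b::finite \<Rightarrow> 's::finite \<Rightarrow> real"
  assumes q: "\<And>s a. pmf q (s, a) = pmf pS s * pmf (pAS s) a"
  shows "lowPi pS Pay pAS \<le> guarantee (\<lambda>_. ()) (\<lambda>(s, a) b. Pay a b s) q"
    and "lowPi_S pS Pay pAS \<le> guarantee fst (\<lambda>(s, a) b. Pay a b s) q"
proof -
  let ?g = "\<lambda>(s, a) b. Pay a b s"
  obtain \<beta> where 1: "guarantee (\<lambda>_. ()) ?g q = (\<Sum>x\<in>UNIV. pmf q x * ?g x (\<beta> ()))"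
    using guarantee_attained[of "\<lambda>_. ()" ?g q] by blast
  show "lowPi pS Pay pAS \<le> guarantee (\<lambda>_. ()) ?g q"
    unfolding 1 lowPi_def payoff3_pure[OF q, of "\<lambda>_. \<beta> ()", symmetric]
    by (intro cINF_lower bdd_below_payoff3[where pB = "\<lambda>pB s. pB"]) auto
  obtain \<beta> where 2: "guarantee fst ?g q = (\<Sum>x\<in>UNIV. pmf q x * ?g x (\<beta> (fst x)))"
    using guarantee_attained[of fst ?g q] by blast
  show "lowPi_S pS Pay pAS \<le> guarantee fst ?g q"
    unfolding 2 lowPi_S_def payoff3_pure[OF q, of \<beta>, symmetric]
    by (rule cINF_lower2[where x = "\<lambda>s. return_pmf (\<beta> s)"])
       (auto intro: bdd_below_payoff3[where pB = "\<lambda>pB s. pB s"])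
qed

text \<open>Minimizers chosen separately for each \<open>u\<close> make up a strategy of a Player B
  who knows U.\<close>

lemma lowPi_U_le_guarantee:
  fixes Pay :: "'a::finite \<Rightarrow> 'b::finite \<Rightarrow> 's::finite \<Rightarrow> real" and pU :: "'u::finite pmf"
  assumes bayes: "\<And>u s. pmf pU u * pmf (pSU u) s = pmf pS s * pmf (pUS s) u"
  shows "lowPi_U pS Pay pUS pAU
      \<le> E pU (\<lambda>u. guarantee (\<lambda>_. ()) (\<lambda>(s, a) b. Pay a b s) (pair_pmf (pSU u) (pAU u)))"
    and "lowPi_SU pS Pay pUS pAU
      \<le> E pU (\<lambda>u. guarantee fst (\<lambda>(s, a) b. Pay a b s) (pair_pmf (pSU u) (pAU u)))"
proof -
  let ?g = "\<lambda>(s, a) b. Pay a b s"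
  let ?V = "\<lambda>u. pair_pmf (pSU u) (pAU u)"
  have "\<forall>u. \<exists>\<beta>. guarantee (\<lambda>_. ()) ?g (?V u) = (\<Sum>x\<in>UNIV. pmf (?V u) x * ?g x (\<beta> ()))"
    using guarantee_attained[of "\<lambda>_. ()" ?g] by blast
  from choice[OF this] obtain \<beta> where
    1: "\<And>u. guarantee (\<lambda>_. ()) ?g (?V u) = (\<Sum>x\<in>UNIV. pmf (?V u) x * ?g x (\<beta> u ()))" by blast
  show "lowPi_U pS Pay pUS pAU \<le> E pU (\<lambda>u. guarantee (\<lambda>_. ()) ?g (?V u))"
    unfolding 1 lowPi_U_def payoff4_pure[OF bayes, where \<beta> = "\<lambda>_ u. \<beta> u ()", symmetric]
    by (rule cINF_lower2[where x = "\<lambda>u. return_pmf (\<beta> u ())"])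
       (auto intro: bdd_below_payoff4[where pB = "\<lambda>pB s u. pB u"])
  have "\<forall>u. \<exists>\<beta>. guarantee fst ?g (?V u) = (\<Sum>x\<in>UNIV. pmf (?V u) x * ?g x (\<beta> (fst x)))"
    using guarantee_attained[of fst ?g] by blast
  from choice[OF this] obtain \<beta> where
    2: "\<And>u. guarantee fst ?g (?V u) = (\<Sum>x\<in>UNIV. pmf (?V u) x * ?g x (\<beta> u (fst x)))" by blast
  show "lowPi_SU pS Pay pUS pAU \<le> E pU (\<lambda>u. guarantee fst ?g (?V u))"
    unfolding 2 lowPi_SU_def payoff4_pure[OF bayes, where \<beta> = "\<lambda>s u. \<beta> u s", symmetric]
    by (rule cINF_lower2[where x = "\<lambda>s u. return_pmf (\<beta> u s)"])
       (auto intro: bdd_below_payoff4[where pB = "\<lambda>pB s u. pB s u"])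
qed

section \<open>Random coding\<close>

text \<open>Erased components become \<open>undefined\<close>, so that channels revealing different parts of \<open>(s, a)\<close> at
  different times share one output type.\<close>

definition blank :: "bool \<Rightarrow> bool \<Rightarrow> 's \<times> 'a \<Rightarrow> 's \<times> 'a" where
  "blank x y = (\<lambda>(s, a). (if x then s else undefined, if y then a else undefined))"

lemma blank_True_True: "blank True True = id"
  by (auto simp: blank_def)

lemma channel_info_blank:
  fixes pSU :: "'u \<Rightarrow> 's pmf" and pAU :: "'u \<Rightarrow> 'a pmf"
  shows "channel_info p (\<lambda>u. map_pmf (blank True True) (pair_pmf (pSU u) (pAU u)))
     = channel_info p (\<lambda>u. pair_pmf (pSU u) (pAU u))"
  "channel_info p (\<lambda>u. map_pmf (blank True False) (pair_pmf (pSU u) (pAU u))) = channel_info p pSU"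
  "channel_info p (\<lambda>u. map_pmf (blank False False) (pair_pmf (pSU u) (pAU u))) = 0"
proof -
  show "channel_info p (\<lambda>u. map_pmf (blank True True) (pair_pmf (pSU u) (pAU u)))
     = channel_info p (\<lambda>u. pair_pmf (pSU u) (pAU u))"
    by (simp add: blank_True_True pmf.map_id)
  have "map_pmf (blank True False) (pair_pmf (pSU u) (pAU u)) = map_pmf (\<lambda>s. (s, undefined)) (pSU u)" for u
  proof -
    have "map_pmf (blank True False) (pair_pmf (pSU u) (pAU u))
        = map_pmf (\<lambda>s. (s, undefined)) (map_pmf fst (pair_pmf (pSU u) (pAU u)))"
      by (simp add: map_pmf_comp blank_def case_prod_unfold del: map_fst_pair_pmf)
    then show ?thesis by (simp only: map_fst_pair_pmf)
  qed
  moreover have "inj (\<lambda>s::'s. (s, undefined::'a))" by (auto simp: inj_def)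
  ultimately show "channel_info p (\<lambda>u. map_pmf (blank True False) (pair_pmf (pSU u) (pAU u))) = channel_info p pSU"
    by (simp add: channel_info_map_inj)
  have "(blank False False :: 's \<times> 'a \<Rightarrow> _) = (\<lambda>_. (undefined, undefined))" by (auto simp: blank_def)
  then show "channel_info p (\<lambda>u. map_pmf (blank False False) (pair_pmf (pSU u) (pAU u))) = 0"
    by (simp add: channel_info_const)
qed

text \<open>The information to be covered: pairs up to \<open>k\<close>, bare states up to
  \<open>l\<close>, nothing afterwards. The uninformed case takes \<open>l = k\<close>, the informed
  case \<open>l = n\<close>.\<close>

lemma sum_channel_info_blank:
  assumes "k \<le> l" "l \<le> n"
  shows "(\<Sum>i<n. channel_info p (\<lambda>u. map_pmf (blank (i < l) (i < k)) (pair_pmf (pSU u) (pAU u))))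
    = k * channel_info p (\<lambda>u. pair_pmf (pSU u) (pAU u)) + (real l - real k) * channel_info p pSU"
proof -
  let ?I = "\<lambda>i. channel_info p (\<lambda>u. map_pmf (blank (i < l) (i < k)) (pair_pmf (pSU u) (pAU u)))"
  have "(\<Sum>i<n. ?I i) = (\<Sum>i=0..<k. ?I i) + (\<Sum>i=k..<l. ?I i) + (\<Sum>i=l..<n. ?I i)"
    using assms by (simp only: sum.atLeastLessThan_concat lessThan_atLeast0 le0 le_trans)
  also have "(\<Sum>i=0..<k. ?I i) = (\<Sum>i=0..<k. channel_info p (\<lambda>u. pair_pmf (pSU u) (pAU u)))"
    using assms by (intro sum.cong refl) (simp add: channel_info_blank)
  also have "(\<Sum>i=k..<l. ?I i) = (\<Sum>i=k..<l. channel_info p pSU)"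
    using assms by (intro sum.cong refl) (simp add: channel_info_blank)
  also have "(\<Sum>i=l..<n. ?I i) = 0"
    using assms by (intro sum.neutral) (simp add: channel_info_blank)
  finally show ?thesis using assms by (simp add: of_nat_diff)
qed

lemma expectation_le_some:
  assumes "finite (set_pmf p)"
  shows "\<exists>x\<in>set_pmf p. E p f \<le> f x"
proof (rule ccontr)
  assume "\<not> ?thesis"
  then have less: "\<And>x. x \<in> set_pmf p \<Longrightarrow> f x < E p f" by force
  have "Max (f ` set_pmf p) < E p f"
    using assms less by (subst Max_less_iff) (auto simp: set_pmf_not_empty)
  moreover have "E p f \<le> E p (\<lambda>_. Max (f ` set_pmf p))"
    using assms by (intro expectation_mono_finite) auto
  ultimately show False by simp
qed

text \<open>\<open>view\<close> says that the views up to now reveal at most \<open>v\<close> of the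
  current pair, \<open>view_t\<close> that the erasure is invisible to Player B in the first
  \<open>k\<close> iterations. Both patterns of state information are instances.\<close>

lemma random_codebook_guarantee:
  fixes pU :: "'u::finite pmf" and pSU :: "'u \<Rightarrow> 's::finite pmf" and pAU :: "'u \<Rightarrow> 'a::finite pmf"
    and Pay :: "'a \<Rightarrow> 'b::finite \<Rightarrow> 's \<Rightarrow> real" and v :: "'s \<times> 'a \<Rightarrow> 'v::finite"
    and t :: "nat \<Rightarrow> 's \<times> 'a \<Rightarrow> 's \<times> 'a"
  assumes M: "M > 0" and n: "n > 0" and k: "k \<le> n"
    and K: "\<And>a b s. \<bar>Pay a b s\<bar> \<le> K"
    and view: "\<And>i j xs x. j \<le> i \<Longrightarrow> i < length xs \<Longrightarrow> v x = v (xs ! i) \<Longrightarrow>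
       bview j (map fst (xs[i := x])) = bview j (map fst xs)"
    and view_t: "\<And>j xs. j < k \<Longrightarrow> length xs = n \<Longrightarrow>
       bview j (map fst (map (\<lambda>i. t i (xs ! i)) [0..<n])) = bview j (map fst xs)"
    and t_id: "\<And>i. i < k \<Longrightarrow> t i = id"
  defines "V \<equiv> \<lambda>u. pair_pmf (pSU u) (pAU u)"
  defines "g \<equiv> \<lambda>(s, a) b. Pay a b s"
  defines "C \<equiv> iprod (\<lambda>_. iprod (\<lambda>_. pU) n) M"
  assumes gap1: "E C (covering_gap pU (\<lambda>_. pSU) n) \<le> \<eta>"
    and gap2: "E C (covering_gap pU (\<lambda>i u. map_pmf (t i) (V u)) n) \<le> \<eta>"
  shows "\<exists>enc fa. (\<forall>ss. set_pmf (enc ss) \<subseteq> {..<M}) \<and>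
    (\<forall>gb. (k * guarantee v g (bind_pmf pU V) + (real n - real k) * E pU (\<lambda>u. guarantee v g (V u))) / n
         - 2 * K * \<eta> \<le> avg_payoff (bind_pmf pU pSU) Pay bview n enc fa gb)"
proof -
  let ?g1 = "covering_gap pU (\<lambda>_. pSU) n" and ?g2 = "covering_gap pU (\<lambda>i u. map_pmf (t i) (V u)) n"
  have K0: "K \<ge> 0" using K[of undefined undefined undefined] by linarith
  have finC: "finite (set_pmf C)" by (simp add: C_def)
  define f where "f c = (k * guarantee v g (bind_pmf pU V)
      + (\<Sum>i=k..<n. (\<Sum>m<M. guarantee v g (V (c ! m ! i))) / M)) / n - K * ?g1 c - K * ?g2 c" for c
  \<comment> \<open>Each letter of a random codeword has law \<open>pU\<close>, so conceding the
    codeword leads on average to the payoff with known U.\<close>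
  have letter: "E C (\<lambda>c. guarantee v g (V (c ! m ! i))) = E pU (\<lambda>u. guarantee v g (V u))"
    if "m < M" "i < n" for m i
    using that unfolding C_def
    by (simp add: expectation_iprod_nth[where f = "\<lambda>us. guarantee v g (V (us ! i))"]
        expectation_iprod_nth[where f = "\<lambda>u. guarantee v g (V u)"])
  have "E C f = (k * guarantee v g (bind_pmf pU V)
      + (\<Sum>i=k..<n. (\<Sum>m<M. E C (\<lambda>c. guarantee v g (V (c ! m ! i)))) / M)) / n - K * E C ?g1 - K * E C ?g2"
    unfolding f_def
    by (simp add: expectation_diff_finite[OF finC] expectation_add_finite[OF finC] expectation_sum_finite[OF finC])
  also have "(\<Sum>i=k..<n. (\<Sum>m<M. E C (\<lambda>c. guarantee v g (V (c ! m ! i)))) / M)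
      = (real n - real k) * E pU (\<lambda>u. guarantee v g (V u))"
    using M k by (simp add: letter of_nat_diff)
  finally have EC: "(k * guarantee v g (bind_pmf pU V) + (real n - real k) * E pU (\<lambda>u. guarantee v g (V u))) / n
      - 2 * K * \<eta> \<le> E C f"
    using mult_left_mono[OF gap1 K0] mult_left_mono[OF gap2 K0] by simp
  obtain c where "c \<in> set_pmf C" and c: "E C f \<le> f c"
    using expectation_le_some[OF finC] by blast
  then have len: "length c = M" unfolding C_def by (auto dest: length_iprod)
  have "\<exists>enc. (\<forall>ss. set_pmf (enc ss) \<subseteq> {..<length c}) \<and>
    (\<forall>gb. f c \<le> avg_payoff (bind_pmf pU pSU) Pay bview n enc (\<lambda>m past h. pAU (c ! m ! length h)) gb)"
    unfolding f_def V_def g_def len[symmetric]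
    by (rule codebook_guarantee[OF _ n k K view view_t t_id]) (use len M in auto)
  then show ?thesis using EC c unfolding len by (meson order_trans)
qed

text \<open>Rounding down loses at most a factor 2 because the power is at least 1.\<close>

lemma num_msgs_ge:
  assumes "R \<ge> 0"
  shows "2 powr (real n * R) / 2 \<le> num_msgs n R" "num_msgs n R > 0"
proof -
  let ?x = "2 powr (real n * R)"
  have x: "?x \<ge> 1" using assms by (intro ge_one_powr_ge_zero) auto
  then have 1: "\<lfloor>?x\<rfloor> \<ge> 1" by simp
  then show "num_msgs n R > 0" by (simp add: num_msgs_def)
  have "real (num_msgs n R) = of_int \<lfloor>?x\<rfloor>" using 1 by (simp add: num_msgs_def)
  moreover have "?x / 2 \<le> of_int \<lfloor>?x\<rfloor>" using 1 x by linarith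
  ultimately show "?x / 2 \<le> num_msgs n R" by simp
qed

text \<open>Two coverings must succeed with the same codebook: the states, at rate I(U;S), and the
  blanked pairs, at rate \<rho>. States are kept in the blanked output up to time
  \<open>l n k\<close>.\<close>

lemma achievable_time_sharing:
  fixes pU :: "'u::finite pmf" and pSU :: "'u \<Rightarrow> 's::finite pmf" and pAU :: "'u \<Rightarrow> 'a::finite pmf"
    and Pay :: "'a \<Rightarrow> 'b::finite \<Rightarrow> 's \<Rightarrow> real" and v :: "'s \<times> 'a \<Rightarrow> 'v::finite"
    and l :: "nat \<Rightarrow> nat \<Rightarrow> nat" and R \<rho> \<tau> P :: real
  assumes \<tau>: "0 \<le> \<tau>" "\<tau> \<le> 1"
    and view: "\<And>i j xs x. j \<le> i \<Longrightarrow> i < length xs \<Longrightarrow> v x = v (xs ! i) \<Longrightarrow>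
       bview j (map fst (xs[i := x])) = bview j (map fst xs)"
    and view_l: "\<And>n k j (xs :: ('s \<times> 'a) list). j < k \<Longrightarrow> k \<le> n \<Longrightarrow> length xs = n \<Longrightarrow>
       bview j (map fst (map (\<lambda>i. blank (i < l n k) (i < k) (xs ! i)) [0..<n])) = bview j (map fst xs)"
    and l: "\<And>n k. k \<le> n \<Longrightarrow> k \<le> l n k \<and> l n k \<le> n"
  defines "V \<equiv> \<lambda>u. pair_pmf (pSU u) (pAU u)"
  defines "g \<equiv> \<lambda>(s, a) b. Pay a b s"
  assumes R: "R > channel_info pU pSU" "R > \<rho>"
    and rate: "\<And>n k. k \<le> n \<Longrightarrow> real k \<le> \<tau> * n \<Longrightarrow>
       k * channel_info pU V + (real (l n k) - real k) * channel_info pU pSU \<le> n * \<rho>"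
    and P: "P \<le> \<tau> * guarantee v g (bind_pmf pU V) + (1 - \<tau>) * E pU (\<lambda>u. guarantee v g (V u))"
  shows "achievable (bind_pmf pU pSU) Pay bview R P"
proof -
  define G1 where "G1 = guarantee v g (bind_pmf pU V)"
  define G2 where "G2 = E pU (\<lambda>u. guarantee v g (V u))"
  define K where "K = (\<Sum>a\<in>UNIV. \<Sum>b\<in>UNIV. \<Sum>s\<in>UNIV. \<bar>Pay a b s\<bar>)"
  have K: "\<bar>Pay a b s\<bar> \<le> K" for a b s
  proof -
    have "\<bar>Pay a b s\<bar> \<le> (\<Sum>s\<in>UNIV. \<bar>Pay a b s\<bar>)" by (rule member_le_sum) auto
    also have "\<dots> \<le> (\<Sum>b\<in>UNIV. \<Sum>s\<in>UNIV. \<bar>Pay a b s\<bar>)"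
      by (rule member_le_sum[where f = "\<lambda>b. \<Sum>s\<in>UNIV. \<bar>Pay a b s\<bar>"]) (auto intro: sum_nonneg)
    also have "\<dots> \<le> K" unfolding K_def
      by (rule member_le_sum[where f = "\<lambda>a. \<Sum>b\<in>UNIV. \<Sum>s\<in>UNIV. \<bar>Pay a b s\<bar>"]) (auto intro: sum_nonneg)
    finally show ?thesis .
  qed
  define moment where "moment W = E (channel_joint pU W) (\<lambda>x. (info_density pU W x - channel_info pU W)\<^sup>2)"
    for W :: "'u \<Rightarrow> ('s \<times> 'a) pmf"
  define B1 where "B1 = E (channel_joint pU pSU) (\<lambda>x. (info_density pU pSU x - channel_info pU pSU)\<^sup>2)"
  \<comment> \<open>One variance bound for all positions and block lengths: four erasure patterns
    occur, besides the plain state channel, whose output type is different.\<close>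
  define B where "B = B1 + (\<Sum>x\<in>UNIV. \<Sum>y\<in>UNIV. moment (\<lambda>u. map_pmf (blank x y) (V u)))"
  have mom0: "moment W \<ge> 0" for W by (simp add: moment_def)
  have B1: "B1 \<ge> 0" by (simp add: B1_def)
  have BW: "moment (\<lambda>u. map_pmf (blank x y) (V u)) \<le> B" for x y
  proof -
    have "moment (\<lambda>u. map_pmf (blank x y) (V u)) \<le> (\<Sum>y\<in>UNIV. moment (\<lambda>u. map_pmf (blank x y) (V u)))"
      by (rule member_le_sum[where f = "\<lambda>y. moment (\<lambda>u. map_pmf (blank x y) (V u))"]) (auto simp: mom0)
    also have "\<dots> \<le> (\<Sum>x\<in>UNIV. \<Sum>y\<in>UNIV. moment (\<lambda>u. map_pmf (blank x y) (V u)))"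
      by (rule member_le_sum[where f = "\<lambda>x. \<Sum>y\<in>UNIV. moment (\<lambda>u. map_pmf (blank x y) (V u))"])
        (auto simp: mom0 intro!: sum_nonneg)
    finally show ?thesis using B1 by (simp add: B_def)
  qed
  have BS: "B1 \<le> B" by (simp add: B_def mom0 sum_nonneg)
  \<comment> \<open>Half the smaller slack: one \<delta> is spent on Chebyshev's deviation, the
    other makes the square-root term decay.\<close>
  define \<delta> where "\<delta> = min (R - channel_info pU pSU) (R - \<rho>) / 2"
  have \<delta>: "\<delta> > 0" using R by (simp add: \<delta>_def)
  have \<delta>R: "channel_info pU pSU \<le> R - 2 * \<delta>" "\<rho> \<le> R - 2 * \<delta>"
    by (auto simp: \<delta>_def)
  have R0: "R \<ge> 0" using channel_info_nonneg[of pU pSU] R by linarith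
  \<comment> \<open>The factor 2 under the root pays for the rounding in
    \<open>num_msgs\<close>.\<close>
  define \<eta> where "\<eta> n = 2 * (B / (real n * \<delta>\<^sup>2)) + sqrt (2 * 2 powr (- (real n * \<delta>)))" for n
  have cover: "E (iprod (\<lambda>_. iprod (\<lambda>_. pU) n) (num_msgs n R)) (covering_gap pU W n) \<le> \<eta> n"
    if n: "n > 0" and I: "(\<Sum>i<n. channel_info pU (W i)) \<le> n * (R - 2 * \<delta>)"
      and mom: "\<And>i. i < n \<Longrightarrow>
        E (channel_joint pU (W i)) (\<lambda>x. (info_density pU (W i) x - channel_info pU (W i))\<^sup>2) \<le> B"
    for n and W :: "nat \<Rightarrow> 'u \<Rightarrow> 'y::finite pmf"
  proof -
    let ?M = "num_msgs n R"
    let ?e = "(\<Sum>i<n. channel_info pU (W i)) + n * \<delta>"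
    have "2 powr ?e \<le> 2 powr (n * R - n * \<delta>)"
      using I by (intro powr_mono) (auto simp: algebra_simps)
    also have "\<dots> = (2 * 2 powr (- (n * \<delta>))) * (2 powr (n * R) / 2)"
      by (simp add: powr_diff powr_minus field_simps)
    also have "\<dots> \<le> (2 * 2 powr (- (n * \<delta>))) * ?M"
      using num_msgs_ge(1)[OF R0] by (intro mult_left_mono) auto
    finally have "2 powr ?e / ?M \<le> 2 * 2 powr (- (n * \<delta>))"
      using num_msgs_ge(2)[OF R0, of n] by (simp add: divide_le_eq)
    then have "sqrt (2 powr ?e / ?M) \<le> sqrt (2 * 2 powr (- (n * \<delta>)))" by simp
    with soft_covering[of \<delta> n ?M pU W B, OF \<delta> n num_msgs_ge(2)[OF R0] mom] show ?thesis
      unfolding \<eta>_def by linarith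
  qed
  show ?thesis
    unfolding achievable_def
  proof (intro allI impI)
    fix \<epsilon> :: real assume "\<epsilon> > 0"
    have "(\<lambda>n. \<bar>G1 - G2\<bar> / real n + 2 * K * \<eta> n) \<longlonglongrightarrow> 0"
      unfolding \<eta>_def using \<delta> by real_asymp
    then have "eventually (\<lambda>n. \<bar>G1 - G2\<bar> / real n + 2 * K * \<eta> n < \<epsilon>) sequentially"
      using \<open>\<epsilon> > 0\<close> by (rule order_tendstoD)
    then obtain N where N: "\<And>n. n \<ge> N \<Longrightarrow> \<bar>G1 - G2\<bar> / real n + 2 * K * \<eta> n < \<epsilon>"
      unfolding eventually_sequentially by blast
    show "\<exists>N. \<forall>n\<ge>N. \<exists>enc fa. (\<forall>ss. set_pmf (enc ss) \<subseteq> {..<num_msgs n R}) \<and>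
        (\<forall>gb. P - \<epsilon> \<le> avg_payoff (bind_pmf pU pSU) Pay bview n enc fa gb)"
    proof (intro exI[of _ "max N 1"] allI impI)
      fix n assume "max N 1 \<le> n"
      then have n: "n > 0" and nN: "n \<ge> N" by auto
      define k where "k = nat \<lfloor>\<tau> * n\<rfloor>"
      have k1: "real k \<le> \<tau> * n" and k2: "\<tau> * n < real k + 1"
        using \<tau> by (auto simp: k_def)
      have "\<tau> * n \<le> n" using \<tau> by (simp add: mult_left_le_one_le)
      then have kn: "k \<le> n" using k1 by linarith
      have "\<exists>enc fa. (\<forall>ss. set_pmf (enc ss) \<subseteq> {..<num_msgs n R}) \<and>
         (\<forall>gb. (k * G1 + (real n - real k) * G2) / n - 2 * K * \<eta> n
            \<le> avg_payoff (bind_pmf pU pSU) Pay bview n enc fa gb)"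
        unfolding G1_def G2_def g_def V_def
      proof (rule random_codebook_guarantee[where t = "\<lambda>i. blank (i < l n k) (i < k)",
            OF num_msgs_ge(2)[OF R0] n kn K view])
        show "E (iprod (\<lambda>_. iprod (\<lambda>_. pU) n) (num_msgs n R)) (covering_gap pU (\<lambda>_. pSU) n) \<le> \<eta> n"
          using BS \<delta>R n by (intro cover) (auto simp: B1_def intro!: mult_left_mono)
        show "E (iprod (\<lambda>_. iprod (\<lambda>_. pU) n) (num_msgs n R))
            (covering_gap pU (\<lambda>i u. map_pmf (blank (i < l n k) (i < k)) (pair_pmf (pSU u) (pAU u))) n) \<le> \<eta> n"
        proof (intro cover n)
          have "n * \<rho> \<le> n * (R - 2 * \<delta>)" using \<delta>R by (intro mult_left_mono) auto
          then show "(\<Sum>i<n. channel_info pU (\<lambda>u. map_pmf (blank (i < l n k) (i < k)) (pair_pmf (pSU u) (pAU u))))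
              \<le> n * (R - 2 * \<delta>)"
            using rate[OF kn k1] l[OF kn] by (simp add: sum_channel_info_blank V_def)
        qed (use BW in \<open>auto simp: moment_def V_def\<close>)
      next
        show "blank (i < l n k) (i < k) = id" if "i < k" for i
          using that l[OF kn] by (simp add: blank_True_True)
      qed (assumption | rule view_l[OF _ kn])+
      moreover have "P - \<epsilon> \<le> (k * G1 + (real n - real k) * G2) / n - 2 * K * \<eta> n"
      proof -
        \<comment> \<open>Rounding \<tau> n down to \<open>k\<close> misplaces less than one
          iteration, worth at most the difference of the two payoffs.\<close>
        have "\<bar>\<tau> * n - k\<bar> * \<bar>G1 - G2\<bar> \<le> 1 * \<bar>G1 - G2\<bar>"
          using k1 k2 by (intro mult_right_mono) auto
        then have "(\<tau> * n - k) * (G1 - G2) \<le> \<bar>G1 - G2\<bar>"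
          using abs_ge_self[of "(\<tau> * n - k) * (G1 - G2)"] by (simp add: abs_mult)
        then have "(\<tau> * G1 + (1 - \<tau>) * G2) * n \<le> k * G1 + (real n - real k) * G2 + \<bar>G1 - G2\<bar>"
          by (simp add: algebra_simps)
        then have "\<tau> * G1 + (1 - \<tau>) * G2 \<le> (k * G1 + (real n - real k) * G2) / n + \<bar>G1 - G2\<bar> / n"
          using n by (simp add: field_simps)
        with P N[OF nN] show ?thesis by (simp add: G1_def G2_def)
      qed
      ultimately show "\<exists>enc fa. (\<forall>ss. set_pmf (enc ss) \<subseteq> {..<num_msgs n R}) \<and>
        (\<forall>gb. P - \<epsilon> \<le> avg_payoff (bind_pmf pU pSU) Pay bview n enc fa gb)"
        by (meson order_trans)
    qed
  qed
qed

section \<open>Reversed test channel, time-sharing fraction and conclusion\<close>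

lemma reversed_channel:
  fixes pS :: "'s::finite pmf" and pUS :: "'s \<Rightarrow> 'u::finite pmf"
  shows "\<exists>pSU. \<forall>u s. pmf (bind_pmf pS pUS) u * pmf (pSU u) s = pmf pS s * pmf (pUS s) u"
proof -
  \<comment> \<open>The weights are those of the states for fixed \<open>u\<close>; where
    \<open>u\<close> has probability 0 the reversed channel is arbitrary.\<close>
  have "\<forall>u. \<exists>e. set_pmf e \<subseteq> UNIV \<and>
      (\<forall>s\<in>UNIV. pmf pS s * pmf (pUS s) u = (\<Sum>s\<in>UNIV. pmf pS s * pmf (pUS s) u) * pmf e s)"
    by (intro allI normalize_weights) auto
  from choice[OF this] show ?thesis
    unfolding pmf_bind_sum_UNIV by (metis UNIV_I)
qed

text \<open>If P \<le> Y, the payoff with known U suffices, while the quotient may be negative or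
  exceed 1; hence the disjunction. Otherwise \<tau> solves \<tau> X + (1 - \<tau>) Y = P, and Y < P
  < X places it in the unit interval.\<close>

lemma time_sharing_fraction:
  fixes P X Y :: real
  assumes "X > P"
  shows "\<exists>\<tau>. 0 \<le> \<tau> \<and> \<tau> \<le> 1 \<and> P \<le> \<tau> * X + (1 - \<tau>) * Y \<and> (\<tau> = 0 \<or> \<tau> = (P - Y) / (X - Y))"
proof (cases "P \<le> Y")
  case True
  then show ?thesis by (intro exI[of _ 0]) auto
next
  case False
  define \<tau> where "\<tau> = (P - Y) / (X - Y)"
  have "\<tau> * (X - Y) = P - Y" using False assms by (simp add: \<tau>_def)
  then have "P \<le> \<tau> * X + (1 - \<tau>) * Y" by (simp add: algebra_simps)
  moreover have "0 \<le> \<tau>" "\<tau> \<le> 1" using False assms by (simp_all add: \<tau>_def)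
  ultimately show ?thesis using \<tau>_def by blast
qed

theorem theorem1:
  fixes pS :: "'s::finite pmf"
    and Pay :: "'a::finite \<Rightarrow> 'b::finite \<Rightarrow> 's \<Rightarrow> real"
    and pUS :: "'s \<Rightarrow> 'u::finite pmf"
    and pAU :: "'u \<Rightarrow> 'a pmf"
    and R P :: real
  shows
   "(lowPi pS Pay (induced_AS pUS pAU) > P \<and>
     R > mutual_info (\<lambda>(u, s). \<Sum>a\<in>UNIV. joint_SUA pS pUS pAU s u a) \<and>
     R > mutual_info (\<lambda>(u, (s, a)). joint_SUA pS pUS pAU s u a) *
         ((P - lowPi_U pS Pay pUS pAU) /
          (lowPi pS Pay (induced_AS pUS pAU) - lowPi_U pS Pay pUS pAU))
     \<longrightarrow> achievable pS Pay (\<lambda>i ss. take i ss) R P)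
    \<and>
    (lowPi_S pS Pay (induced_AS pUS pAU) > P \<and>
     R > mutual_info (\<lambda>(u, s). \<Sum>a\<in>UNIV. joint_SUA pS pUS pAU s u a) +
         cond_mutual_info (\<lambda>(u, a, s). joint_SUA pS pUS pAU s u a) *
         max 0 ((P - lowPi_SU pS Pay pUS pAU) /
                (lowPi_S pS Pay (induced_AS pUS pAU) - lowPi_SU pS Pay pUS pAU))
     \<longrightarrow> achievable pS Pay (\<lambda>i ss. ss) R P)"
proof -
  define pU where "pU = bind_pmf pS pUS"
  obtain pSU where bayes: "\<And>u s. pmf pU u * pmf (pSU u) s = pmf pS s * pmf (pUS s) u"
    using reversed_channel[of pS pUS] unfolding pU_def by blast
  define V where "V u = pair_pmf (pSU u) (pAU u)" for u
  let ?g = "\<lambda>(s, a) b. Pay a b s"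
  let ?Icond = "cond_mutual_info (\<lambda>(u, a, s). joint_SUA pS pUS pAU s u a)"
  have pS: "bind_pmf pU pSU = pS"
    by (rule pmf_eqI) (simp add: pmf_bind_sum_UNIV bayes sum_distrib_left[symmetric])
  have pSA: "pmf (bind_pmf pU V) (s, a) = pmf pS s * pmf (induced_AS pUS pAU s) a" for s a
    by (simp add: pmf_bind_sum_UNIV V_def pmf_pair induced_AS_def bayes[symmetric]
        sum_distrib_left mult.assoc[symmetric])
  have I_S: "mutual_info (\<lambda>(u, s). \<Sum>a\<in>UNIV. joint_SUA pS pUS pAU s u a) = channel_info pU pSU"
    by (rule mutual_info_eq_channel_info) (simp add: joint_SUA_def bayes sum_distrib_left[symmetric])
  have I_V: "mutual_info (\<lambda>(u, (s, a)). joint_SUA pS pUS pAU s u a) = channel_info pU V"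
    by (rule mutual_info_eq_channel_info)
      (auto simp: joint_SUA_def V_def pmf_pair bayes mult.assoc[symmetric])
  have chain: "channel_info pU V = channel_info pU pSU + ?Icond"
    unfolding V_def by (rule mutual_info_chain_rule) (simp add: joint_SUA_def bayes)
  have combine: "P \<le> \<tau> * X' + (1 - \<tau>) * Y'"
    if "P \<le> \<tau> * X + (1 - \<tau>) * Y" "0 \<le> \<tau>" "\<tau> \<le> 1" "X \<le> X'" "Y \<le> Y'" for \<tau> X X' Y Y'
    using mult_left_mono[OF that(4,2)] mult_left_mono[OF that(5), of "1 - \<tau>"] that by linarith
  show ?thesis
  proof (intro conjI impI; elim conjE)
    let ?X = "lowPi pS Pay (induced_AS pUS pAU)" and ?Y = "lowPi_U pS Pay pUS pAU"
    assume X: "?X > P" and R1: "R > mutual_info (\<lambda>(u, s). \<Sum>a\<in>UNIV. joint_SUA pS pUS pAU s u a)"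
      and R2: "R > mutual_info (\<lambda>(u, (s, a)). joint_SUA pS pUS pAU s u a) * ((P - ?Y) / (?X - ?Y))"
    obtain \<tau> where \<tau>: "0 \<le> \<tau>" "\<tau> \<le> 1" "P \<le> \<tau> * ?X + (1 - \<tau>) * ?Y"
      and \<tau>_cases: "\<tau> = 0 \<or> \<tau> = (P - ?Y) / (?X - ?Y)"
      using time_sharing_fraction[OF X] by blast
    have R: "R > channel_info pU pSU" using R1 by (simp add: I_S)
    \<comment> \<open>For \<tau> = 0 this reads \<open>R > 0\<close>, which comes from R > I(U;S)
      \<ge> 0.\<close>
    have R': "R > \<tau> * channel_info pU V"
      using \<tau>_cases R R2 channel_info_nonneg[of pU pSU] by (auto simp: I_V mult.commute)
    \<comment> \<open>The current state is hidden, so \<open>v\<close> is constant; before iteration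
      \<open>k\<close> only states of index below \<open>k\<close> have been seen, so
      \<open>l\<close> stops at \<open>k\<close>.\<close>
    have "achievable (bind_pmf pU pSU) Pay (\<lambda>i ss. take i ss) R P"
    proof (rule achievable_time_sharing[where v = "\<lambda>_. ()" and l = "\<lambda>n k. k" and \<tau> = \<tau>
          and \<rho> = "\<tau> * channel_info pU V" and pAU = pAU])
      fix n k j :: nat and xs :: "('s \<times> 'a) list"
      assume "j < k" "k \<le> n" "length xs = n"
      then show "take j (map fst (map (\<lambda>i. blank (i < k) (i < k) (xs ! i)) [0..<n])) = take j (map fst xs)"
        by (intro nth_equalityI) (auto simp: blank_True_True)
    next
      fix n k :: nat
      assume "real k \<le> \<tau> * real n"
      then have "real k * channel_info pU V \<le> \<tau> * real n * channel_info pU V"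
        by (rule mult_right_mono[OF _ channel_info_nonneg])
      then show "real k * channel_info pU (\<lambda>u. pair_pmf (pSU u) (pAU u)) + (real k - real k) * channel_info pU pSU
          \<le> real n * (\<tau> * channel_info pU V)"
        unfolding V_def[abs_def, symmetric] by (simp add: mult_ac)
    next
      show "P \<le> \<tau> * guarantee (\<lambda>_. ()) ?g (bind_pmf pU (\<lambda>u. pair_pmf (pSU u) (pAU u)))
          + (1 - \<tau>) * E pU (\<lambda>u. guarantee (\<lambda>_. ()) ?g (pair_pmf (pSU u) (pAU u)))"
        using combine[OF \<tau>(3,1,2) lowPi_le_guarantee(1)[OF pSA] lowPi_U_le_guarantee(1)[OF bayes]]
        unfolding V_def[abs_def] .
    qed (use \<tau> R R' in \<open>auto simp: map_update\<close>)
    then show "achievable pS Pay (\<lambda>i ss. take i ss) R P" by (simp add: pS)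
  next
    let ?X = "lowPi_S pS Pay (induced_AS pUS pAU)" and ?Y = "lowPi_SU pS Pay pUS pAU"
    assume X: "?X > P" and R2: "R > mutual_info (\<lambda>(u, s). \<Sum>a\<in>UNIV. joint_SUA pS pUS pAU s u a)
        + ?Icond * max 0 ((P - ?Y) / (?X - ?Y))"
    obtain \<tau> where \<tau>: "0 \<le> \<tau>" "\<tau> \<le> 1" "P \<le> \<tau> * ?X + (1 - \<tau>) * ?Y"
      and \<tau>_cases: "\<tau> = 0 \<or> \<tau> = (P - ?Y) / (?X - ?Y)"
      using time_sharing_fraction[OF X] by blast
    have cond0: "?Icond \<ge> 0" by (rule cond_mutual_info_nonneg)
    have "\<tau> \<le> max 0 ((P - ?Y) / (?X - ?Y))" using \<tau>_cases by auto
    then have "?Icond * \<tau> \<le> ?Icond * max 0 ((P - ?Y) / (?X - ?Y))"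
      by (rule mult_left_mono[OF _ cond0])
    then have R': "R > channel_info pU pSU + \<tau> * ?Icond"
      using R2 unfolding I_S mult.commute[of \<tau>] by linarith
    then have R: "R > channel_info pU pSU"
      using mult_nonneg_nonneg[OF \<tau>(1) cond0] by linarith
    \<comment> \<open>The current state is visible, so \<open>v\<close> is \<open>fst\<close>; all
      \<open>n\<close> states are in view from the start, so \<open>l\<close> is \<open>n\<close>
      and only actions are erased after \<open>k\<close>.\<close>
    have "achievable (bind_pmf pU pSU) Pay (\<lambda>i ss. ss) R P"
    proof (rule achievable_time_sharing[where v = fst and l = "\<lambda>n k. n" and \<tau> = \<tau>
          and \<rho> = "channel_info pU pSU + \<tau> * ?Icond" and pAU = pAU])
      fix i :: nat and xs :: "('s \<times> 'a) list" and x :: "'s \<times> 'a"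
      assume "i < length xs" "fst x = fst (xs ! i)"
      then show "map fst (xs[i := x]) = map fst xs"
        by (simp add: map_update list_update_same_conv)
    next
      fix n k j :: nat and xs :: "('s \<times> 'a) list"
      assume "length xs = n"
      then show "map fst (map (\<lambda>i. blank (i < n) (i < k) (xs ! i)) [0..<n]) = map fst xs"
        by (intro nth_equalityI) (auto simp: blank_def case_prod_unfold)
    next
      fix n k :: nat
      assume "real k \<le> \<tau> * real n"
      then have "real k * ?Icond \<le> \<tau> * real n * ?Icond" by (rule mult_right_mono[OF _ cond0])
      then show "real k * channel_info pU (\<lambda>u. pair_pmf (pSU u) (pAU u)) + (real n - real k) * channel_info pU pSU
          \<le> real n * (channel_info pU pSU + \<tau> * ?Icond)"
        unfolding V_def[abs_def, symmetric] chain by (simp add: algebra_simps)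
    next
      show "P \<le> \<tau> * guarantee fst ?g (bind_pmf pU (\<lambda>u. pair_pmf (pSU u) (pAU u)))
          + (1 - \<tau>) * E pU (\<lambda>u. guarantee fst ?g (pair_pmf (pSU u) (pAU u)))"
        using combine[OF \<tau>(3,1,2) lowPi_le_guarantee(2)[OF pSA] lowPi_U_le_guarantee(2)[OF bayes]]
        unfolding V_def[abs_def] .
    qed (use \<tau> R R' in auto)
    then show "achievable pS Pay (\<lambda>i ss. ss) R P" by (simp add: pS)
  qed
qed

end
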